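(* Let $\star$ be any state over time function satisfying the classical limit axiom. Let $\mathcal{B}$ be a multi-matrix algebra, let $X$ be a finite set, and let $\mathcal{E}=\mathrm{tr}\otimes\mathrm{id}_{\mathbb{C}^X}:\mathcal{B}\otimes\mathbb{C}^X\to\mathbb{C}^X$ be the partial trace map that traces out $\mathcal{B}$. Let $\rho\in\mathcal{B}\otimes\mathbb{C}^X$ be any state, written as $\rho=\sum_{x\in X}\rho_x\otimes\delta_x$ with each $\rho_x\in\mathcal{B}$ positive, and assume that $\rho_x\neq 0$ for all $x\in X$. Then a Bayesian inverse $\mathcal{E}^{\star}_{\rho}:\mathbb{C}^X\to\mathcal{B}\otimes\mathbb{C}^X$ of $(\mathcal{E},\rho)$ with respect to $\star$ exists, is unique, and is given by $$\mathcal{E}^{\star}_{\rho}(\delta_x)=\frac{\rho_x}{\mathrm{tr}(\rho_x)}\otimes\delta_x\qquad\text{for all }x\in X.$$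
   Context: A multi-matrix algebra is a finite direct sum $\mathcal{A}=\bigoplus_{x\in X}\mathbb{M}_{m_x}$ of complex matrix algebras ($X$ a finite set, $m_x$ positive integers), with componentwise multiplication and componentwise conjugate transpose $\dagger$; $1_{\mathcal{A}}$ is its unit and $\mathrm{tr}(A)=\sum_x\mathrm{tr}(A_x)$ its (un-normalized) trace. A state (density matrix) is a positive element of trace $1$; $\mathcal{S}(\mathcal{A})$ is the set of states. $\mathrm{CPTP}(\mathcal{A},\mathcal{B})$ is the set of completely positive trace-preserving linear maps $\mathcal{A}\to\mathcal{B}$. $\mathbb{C}^X=\bigoplus_{x\in X}\mathbb{C}$, and $\delta_x\in\mathbb{C}^X$ is the unit vector with $x$ component $1$ and other components $0$. The Hilbert–Schmidt adjoint $\Phi^*:\mathcal{B}\to\mathcal{A}$ of a linear map $\Phi:\mathcal{A}\to\mathcal{B}$ is defined by $\mathrm{tr}(\Phi(A)^{\dagger}B)=\mathrm{tr}(A^{\dagger}\Phi^*(B))$. Let $\mu_{\mathcal{A}}:\mathcal{A}\otimes\mathcal{A}\to\mathcal{A}$ be the multiplication map $A_1\otimes A_2\mapsto A_1A_2$. The channel state of a linear map $\Phi:\mathcal{A}\to\mathcal{B}$ is $\mathscr{D}[\Phi]=(\mathrm{id}_{\mathcal{A}}\otimes\Phi)(\mu_{\mathcal{A}}^*(1_{\mathcal{A}}))\in\mathcal{A}\otimes\mathcal{B}$. A state over time function $\star$ associates to every pair $(\mathcal{A},\mathcal{B})$ of multi-matrix algebras a map $\mathrm{CPTP}(\mathcal{A},\mathcal{B})\times\mathcal{S}(\mathcal{A})\to\mathcal{A}\otimes\mathcal{B}$,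 $(\Phi,\rho)\mapsto\Phi\star\rho$, such that $\mathrm{tr}_{\mathcal{B}}(\Phi\star\rho)=\rho$ and $\mathrm{tr}_{\mathcal{A}}(\Phi\star\rho)=\Phi(\rho)$, where $\mathrm{tr}_{\mathcal{B}}:\mathcal{A}\otimes\mathcal{B}\to\mathcal{A}$ and $\mathrm{tr}_{\mathcal{A}}:\mathcal{A}\otimes\mathcal{B}\to\mathcal{B}$ are the partial traces. It satisfies the classical limit axiom iff, for all multi-matrix algebras $\mathcal{A},\mathcal{B}$, all $\rho\in\mathcal{S}(\mathcal{A})$ and all $\Phi\in\mathrm{CPTP}(\mathcal{A},\mathcal{B})$, the condition $[\mathscr{D}[\Phi],\rho\otimes 1_{\mathcal{B}}]=0$ implies $\Phi\star\rho=\mathscr{D}[\Phi](\rho\otimes 1_{\mathcal{B}})$. A Bayesian inverse of $(\Phi,\rho)$, with $\Phi\in\mathrm{CPTP}(\mathcal{A},\mathcal{B})$ and $\rho\in\mathcal{S}(\mathcal{A})$, with respect to $\star$ is a CPTP map $\Phi^{\star}_{\rho}:\mathcal{B}\to\mathcal{A}$ such that $\Phi\star\rho=\tau(\Phi^{\star}_{\rho}\star\Phi(\rho))$, where $\tau:\mathcal{B}\otimes\mathcal{A}\to\mathcal{A}\otimes\mathcal{B}$ is the unique conjugate-linear map with $\tau(B\otimes A)=A^{\dagger}\otimes B^{\dagger}$. *)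

theory Defs
  imports "Jordan_Normal_Form.Schur_Decomposition" "HOL-Library.FuncSet"
begin

section \<open>Multi-matrix algebras\<close>

text \<open>
  The index sets of the direct sums live in one type that is closed under pairing, so that a
  state over time function can be a single HOL function defined on all pairs of algebras and
  tensor products of algebras are again algebras of the same kind.  The type parameter is
  arbitrary.
\<close>

datatype 'i label = Lbl 'i | LPair "'i label" "'i label"

text \<open>
  The algebra that is the direct sum over \<open>x \<in> X\<close> of the full matrix algebras of size \<open>m\<^sub>x\<close>, with
  all \<open>m\<^sub>x\<close> positive, is given by its dimension function extended by \<open>0\<close> outside \<open>X\<close>; so
  \<open>X = {x. A x \<noteq> 0}\<close>.  An element of the algebra is a family of square blocks; at a label
  outside \<open>X\<close> the block is necessarily the \<open>0 \<times> 0\<close> matrix.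
\<close>

type_synonym 'i alg = "'i label \<Rightarrow> nat"
type_synonym 'i elem = "'i label \<Rightarrow> complex mat"

definition multi_matrix :: "'i alg \<Rightarrow> bool" where
  "multi_matrix A \<longleftrightarrow> finite {x. A x \<noteq> 0}"

definition elems :: "'i alg \<Rightarrow> 'i elem set" where
  "elems A = {a. \<forall>x. a x \<in> carrier_mat (A x) (A x)}"

definition ezero :: "'i alg \<Rightarrow> 'i elem" where
  "ezero A = (\<lambda>x. 0\<^sub>m (A x) (A x))"

definition eone :: "'i alg \<Rightarrow> 'i elem" where
  "eone A = (\<lambda>x. 1\<^sub>m (A x))"

definition eadd :: "'i elem \<Rightarrow> 'i elem \<Rightarrow> 'i elem"  (infixl "+\<^sub>e" 65) where
  "a +\<^sub>e b = (\<lambda>x. a x + b x)"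

definition esmult :: "complex \<Rightarrow> 'i elem \<Rightarrow> 'i elem"  (infixr "\<cdot>\<^sub>e" 75) where
  "c \<cdot>\<^sub>e a = (\<lambda>x. c \<cdot>\<^sub>m a x)"

definition emult :: "'i elem \<Rightarrow> 'i elem \<Rightarrow> 'i elem"  (infixl "*\<^sub>e" 70) where
  "a *\<^sub>e b = (\<lambda>x. a x * b x)"

definition eadj :: "'i elem \<Rightarrow> 'i elem" where
  "eadj a = (\<lambda>x. mat_adjoint (a x))"

definition ecomm :: "'i elem \<Rightarrow> 'i elem \<Rightarrow> 'i elem" where
  "ecomm a b = (\<lambda>x. a x * b x - b x * a x)"

definition esum :: "'i alg \<Rightarrow> ('s \<Rightarrow> 'i elem) \<Rightarrow> 's set \<Rightarrow> 'i elem" where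
  "esum A f S = (\<lambda>x. mat (A x) (A x) (\<lambda>(i, j). \<Sum>s\<in>S. f s x $$ (i, j)))"

definition etr :: "'i alg \<Rightarrow> 'i elem \<Rightarrow> complex" where
  "etr A a = (\<Sum>x | A x \<noteq> 0. \<Sum>i<A x. a x $$ (i, i))"

definition epos :: "'i alg \<Rightarrow> 'i elem \<Rightarrow> bool" where
  "epos A a \<longleftrightarrow> (\<exists>c\<in>elems A. a = eadj c *\<^sub>e c)"

definition states :: "'i alg \<Rightarrow> 'i elem set" where
  "states A = {\<rho>. epos A \<rho> \<and> etr A \<rho> = 1}"

definition full_matrix_alg :: "'i label \<Rightarrow> nat \<Rightarrow> 'i alg" where
  "full_matrix_alg l n = (\<lambda>x. if x = l then n else 0)"

definition classical_alg :: "'i label set \<Rightarrow> 'i alg" where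
  "classical_alg X = (\<lambda>x. if x \<in> X then 1 else 0)"

definition delta :: "'i label set \<Rightarrow> 'i label \<Rightarrow> 'i elem" where
  "delta X x = (\<lambda>y. if y = x then 1\<^sub>m (classical_alg X y)
                    else 0\<^sub>m (classical_alg X y) (classical_alg X y))"


section \<open>Tensor products\<close>

definition kron :: "complex mat \<Rightarrow> complex mat \<Rightarrow> complex mat" where
  "kron a b = mat (dim_row a * dim_row b) (dim_col a * dim_col b)
     (\<lambda>(i, j). a $$ (i div dim_row b, j div dim_col b) * b $$ (i mod dim_row b, j mod dim_col b))"

definition tensor_alg :: "'i alg \<Rightarrow> 'i alg \<Rightarrow> 'i alg"  (infixl "\<otimes>\<^sub>a" 70) where
  "A \<otimes>\<^sub>a B = (\<lambda>z. case z of Lbl _ \<Rightarrow> 0 | LPair x y \<Rightarrow> A x * B y)"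

definition tensor_elem :: "'i elem \<Rightarrow> 'i elem \<Rightarrow> 'i elem"  (infixl "\<otimes>\<^sub>e" 72) where
  "a \<otimes>\<^sub>e b = (\<lambda>z. case z of Lbl _ \<Rightarrow> 0\<^sub>m 0 0 | LPair x y \<Rightarrow> kron (a x) (b y))"


section \<open>Linear maps\<close>

text \<open>
  Maps between algebras are extensional functions, so equality of functions is equality of maps.
\<close>

definition lin_maps :: "'i alg \<Rightarrow> 'i alg \<Rightarrow> ('i elem \<Rightarrow> 'i elem) set" where
  "lin_maps A B = {\<Phi> \<in> elems A \<rightarrow>\<^sub>E elems B.
     (\<forall>a\<in>elems A. \<forall>a'\<in>elems A. \<Phi> (a +\<^sub>e a') = \<Phi> a +\<^sub>e \<Phi> a') \<and>
     (\<forall>c. \<forall>a\<in>elems A. \<Phi> (c \<cdot>\<^sub>e a) = c \<cdot>\<^sub>e \<Phi> a)}"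

definition conj_lin_maps :: "'i alg \<Rightarrow> 'i alg \<Rightarrow> ('i elem \<Rightarrow> 'i elem) set" where
  "conj_lin_maps A B = {\<Phi> \<in> elems A \<rightarrow>\<^sub>E elems B.
     (\<forall>a\<in>elems A. \<forall>a'\<in>elems A. \<Phi> (a +\<^sub>e a') = \<Phi> a +\<^sub>e \<Phi> a') \<and>
     (\<forall>c. \<forall>a\<in>elems A. \<Phi> (c \<cdot>\<^sub>e a) = cnj c \<cdot>\<^sub>e \<Phi> a)}"

definition bilinear_map :: "'i alg \<Rightarrow> 'i alg \<Rightarrow> 'i alg \<Rightarrow> ('i elem \<Rightarrow> 'i elem \<Rightarrow> 'i elem) \<Rightarrow> bool" where
  "bilinear_map A B C f \<longleftrightarrow>
     (\<forall>a\<in>elems A. (\<lambda>b\<in>elems B. f a b) \<in> lin_maps B C) \<and>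
     (\<forall>b\<in>elems B. (\<lambda>a\<in>elems A. f a b) \<in> lin_maps A C)"

text \<open>
  The linear map on a tensor product that is induced by a bilinear map.
\<close>

definition tensor_lift ::
  "'i alg \<Rightarrow> 'i alg \<Rightarrow> 'i alg \<Rightarrow> ('i elem \<Rightarrow> 'i elem \<Rightarrow> 'i elem) \<Rightarrow> 'i elem \<Rightarrow> 'i elem" where
  "tensor_lift A B C f = (THE \<Psi>. \<Psi> \<in> lin_maps (A \<otimes>\<^sub>a B) C \<and>
     (\<forall>a\<in>elems A. \<forall>b\<in>elems B. \<Psi> (a \<otimes>\<^sub>e b) = f a b))"

definition id_tensor ::
  "'i alg \<Rightarrow> 'i alg \<Rightarrow> 'i alg \<Rightarrow> ('i elem \<Rightarrow> 'i elem) \<Rightarrow> 'i elem \<Rightarrow> 'i elem" where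
  "id_tensor C A B \<Phi> = tensor_lift C A (C \<otimes>\<^sub>a B) (\<lambda>c a. c \<otimes>\<^sub>e \<Phi> a)"

text \<open>\<open>ptr_fst A B\<close> traces out \<open>A\<close> and \<open>ptr_snd A B\<close> traces out \<open>B\<close>.\<close>

definition ptr_fst :: "'i alg \<Rightarrow> 'i alg \<Rightarrow> 'i elem \<Rightarrow> 'i elem" where
  "ptr_fst A B = tensor_lift A B B (\<lambda>a b. etr A a \<cdot>\<^sub>e b)"

definition ptr_snd :: "'i alg \<Rightarrow> 'i alg \<Rightarrow> 'i elem \<Rightarrow> 'i elem" where
  "ptr_snd A B = tensor_lift A B A (\<lambda>a b. etr B b \<cdot>\<^sub>e a)"

definition mult_map :: "'i alg \<Rightarrow> 'i elem \<Rightarrow> 'i elem" where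
  "mult_map A = tensor_lift A A A (\<lambda>a b. a *\<^sub>e b)"

definition hs_adjoint ::
  "'i alg \<Rightarrow> 'i alg \<Rightarrow> ('i elem \<Rightarrow> 'i elem) \<Rightarrow> 'i elem \<Rightarrow> 'i elem" where
  "hs_adjoint A B \<Phi> = (THE \<Psi>. \<Psi> \<in> lin_maps B A \<and>
     (\<forall>a\<in>elems A. \<forall>b\<in>elems B. etr B (eadj (\<Phi> a) *\<^sub>e b) = etr A (eadj a *\<^sub>e \<Psi> b)))"

definition time_reversal :: "'i alg \<Rightarrow> 'i alg \<Rightarrow> 'i elem \<Rightarrow> 'i elem" where
  "time_reversal B A = (THE \<tau>. \<tau> \<in> conj_lin_maps (B \<otimes>\<^sub>a A) (A \<otimes>\<^sub>a B) \<and>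
     (\<forall>b\<in>elems B. \<forall>a\<in>elems A. \<tau> (b \<otimes>\<^sub>e a) = eadj a \<otimes>\<^sub>e eadj b))"


section \<open>Channels, states over time and Bayesian inverses\<close>

definition positive_map :: "'i alg \<Rightarrow> 'i alg \<Rightarrow> ('i elem \<Rightarrow> 'i elem) \<Rightarrow> bool" where
  "positive_map A B \<Phi> \<longleftrightarrow> (\<forall>a. epos A a \<longrightarrow> epos B (\<Phi> a))"

definition completely_positive :: "'i alg \<Rightarrow> 'i alg \<Rightarrow> ('i elem \<Rightarrow> 'i elem) \<Rightarrow> bool" where
  "completely_positive A B \<Phi> \<longleftrightarrow>
     (\<forall>l n. positive_map (full_matrix_alg l n \<otimes>\<^sub>a A) (full_matrix_alg l n \<otimes>\<^sub>a B)
              (id_tensor (full_matrix_alg l n) A B \<Phi>))"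

definition CPTP :: "'i alg \<Rightarrow> 'i alg \<Rightarrow> ('i elem \<Rightarrow> 'i elem) set" where
  "CPTP A B = {\<Phi> \<in> lin_maps A B. completely_positive A B \<Phi> \<and>
     (\<forall>a\<in>elems A. etr B (\<Phi> a) = etr A a)}"

definition channel_state :: "'i alg \<Rightarrow> 'i alg \<Rightarrow> ('i elem \<Rightarrow> 'i elem) \<Rightarrow> 'i elem" where
  "channel_state A B \<Phi> = id_tensor A A B \<Phi> (hs_adjoint (A \<otimes>\<^sub>a A) A (mult_map A) (eone A))"

type_synonym 'i sot = "'i alg \<Rightarrow> 'i alg \<Rightarrow> ('i elem \<Rightarrow> 'i elem) \<Rightarrow> 'i elem \<Rightarrow> 'i elem"

definition state_over_time_function :: "'i sot \<Rightarrow> bool" where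
  "state_over_time_function star \<longleftrightarrow>
     (\<forall>A B \<Phi> \<rho>. multi_matrix A \<longrightarrow> multi_matrix B \<longrightarrow> \<Phi> \<in> CPTP A B \<longrightarrow> \<rho> \<in> states A \<longrightarrow>
        star A B \<Phi> \<rho> \<in> elems (A \<otimes>\<^sub>a B) \<and>
        ptr_snd A B (star A B \<Phi> \<rho>) = \<rho> \<and>
        ptr_fst A B (star A B \<Phi> \<rho>) = \<Phi> \<rho>)"

definition classical_limit_axiom :: "'i sot \<Rightarrow> bool" where
  "classical_limit_axiom star \<longleftrightarrow>
     (\<forall>A B \<Phi> \<rho>. multi_matrix A \<longrightarrow> multi_matrix B \<longrightarrow> \<Phi> \<in> CPTP A B \<longrightarrow> \<rho> \<in> states A \<longrightarrow>
        ecomm (channel_state A B \<Phi>) (\<rho> \<otimes>\<^sub>e eone B) = ezero (A \<otimes>\<^sub>a B) \<longrightarrow>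
        star A B \<Phi> \<rho> = channel_state A B \<Phi> *\<^sub>e (\<rho> \<otimes>\<^sub>e eone B))"

definition bayesian_inverse ::
  "'i sot \<Rightarrow> 'i alg \<Rightarrow> 'i alg \<Rightarrow> ('i elem \<Rightarrow> 'i elem) \<Rightarrow> 'i elem \<Rightarrow> ('i elem \<Rightarrow> 'i elem) \<Rightarrow> bool" where
  "bayesian_inverse star A B \<Phi> \<rho> \<Psi> \<longleftrightarrow>
     \<Phi> \<in> CPTP A B \<and> \<rho> \<in> states A \<and> \<Psi> \<in> CPTP B A \<and>
     star A B \<Phi> \<rho> = time_reversal B A (star B A \<Psi> (\<Phi> \<rho>))"


section \<open>Well-definedness\<close>

text \<open>
  The maps introduced above by definite description exist and are unique.  The algebra \<open>A\<close> has
  the basis of matrix units \<open>munit A e\<close>, indexed by the triples \<open>e = (x, i, j)\<close> in \<open>bas A\<close>;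
  \<open>ecoef\<close> and \<open>tcoef\<close> are the coordinates in \<open>A\<close> and in a tensor product.
\<close>

lemma elemsD: "a \<in> elems A \<Longrightarrow> dim_row (a x) = A x \<and> dim_col (a x) = A x"
  unfolding elems_def by auto

lemma elemsI: "(\<And>x. dim_row (a x) = A x) \<Longrightarrow> (\<And>x. dim_col (a x) = A x) \<Longrightarrow> a \<in> elems A"
  unfolding elems_def by auto

lemma elems_eqI:
  assumes "a \<in> elems A" "b \<in> elems A"
    and "\<And>x i j. i < A x \<Longrightarrow> j < A x \<Longrightarrow> a x $$ (i, j) = b x $$ (i, j)"
  shows "a = b"
proof
  fix x show "a x = b x"
    using assms elemsD[OF assms(1), of x] elemsD[OF assms(2), of x] by (intro eq_matI) auto
qed

lemma mat_adjoint_dims [simp]: "dim_row (mat_adjoint A) = dim_col A" "dim_col (mat_adjoint A) = dim_row A"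
  unfolding mat_adjoint_def by auto

lemma mat_adjoint_index [simp]:
  "i < dim_col A \<Longrightarrow> j < dim_row A \<Longrightarrow> mat_adjoint (A :: complex mat) $$ (i, j) = cnj (A $$ (j, i))"
  unfolding mat_adjoint_def by (simp add: mat_of_rows_index)

lemma elems_closed [simp]:
  "a \<in> elems A \<Longrightarrow> b \<in> elems A \<Longrightarrow> a +\<^sub>e b \<in> elems A"
  "a \<in> elems A \<Longrightarrow> c \<cdot>\<^sub>e a \<in> elems A"
  "a \<in> elems A \<Longrightarrow> b \<in> elems A \<Longrightarrow> a *\<^sub>e b \<in> elems A"
  "a \<in> elems A \<Longrightarrow> eadj a \<in> elems A"
  "esum A f S \<in> elems A"
  "ezero A \<in> elems A"
  by (auto intro!: elemsI simp: eadd_def esmult_def emult_def eadj_def esum_def ezero_def elemsD)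

lemma tensor_elems [simp]: "a \<in> elems A \<Longrightarrow> b \<in> elems B \<Longrightarrow> a \<otimes>\<^sub>e b \<in> elems (A \<otimes>\<^sub>a B)"
  by (auto intro!: elemsI simp: tensor_elem_def tensor_alg_def kron_def elemsD split: label.splits)

lemma multi_matrix_tensor:
  assumes "multi_matrix A" "multi_matrix B" shows "multi_matrix (A \<otimes>\<^sub>a B)"
proof -
  have "{z. (A \<otimes>\<^sub>a B) z \<noteq> 0} \<subseteq> (\<lambda>(x, y). LPair x y) ` ({x. A x \<noteq> 0} \<times> {y. B y \<noteq> 0})"
  proof
    fix z assume "z \<in> {z. (A \<otimes>\<^sub>a B) z \<noteq> 0}"
    then show "z \<in> (\<lambda>(x, y). LPair x y) ` ({x. A x \<noteq> 0} \<times> {y. B y \<noteq> 0})"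
      by (cases z) (auto simp: tensor_alg_def)
  qed
  then show ?thesis using assms unfolding multi_matrix_def
    by (meson finite_SigmaI finite_imageI finite_subset)
qed

definition munit :: "'i alg \<Rightarrow> 'i label \<times> nat \<times> nat \<Rightarrow> 'i elem" where
  "munit A e = (\<lambda>z. mat (A z) (A z) (\<lambda>p. if (z, p) = e then 1 else 0))"

definition bas :: "'i alg \<Rightarrow> ('i label \<times> nat \<times> nat) set" where
  "bas A = (SIGMA x:{x. A x \<noteq> 0}. {..<A x} \<times> {..<A x})"

definition ecoef :: "'i elem \<Rightarrow> 'i label \<times> nat \<times> nat \<Rightarrow> complex" where
  "ecoef a e = a (fst e) $$ snd e"

definition tcoef :: "'i alg \<Rightarrow> 'i elem \<Rightarrow> ('i label \<times> nat \<times> nat) \<times> ('i label \<times> nat \<times> nat) \<Rightarrow> complex" where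
  "tcoef B T = (\<lambda>((x, i, j), (y, k, l)). T (LPair x y) $$ (i * B y + k, j * B y + l))"

lemma finite_bas [simp]: "multi_matrix A \<Longrightarrow> finite (bas A)"
  unfolding bas_def multi_matrix_def by auto

lemma bas_iff: "(x, i, j) \<in> bas A \<longleftrightarrow> i < A x \<and> j < A x"
  unfolding bas_def by auto

lemma munit_elems [simp]: "munit A e \<in> elems A"
  by (auto intro!: elemsI simp: munit_def)

lemma expand:
  assumes A: "multi_matrix A" and a: "a \<in> elems A"
  shows "a = esum A (\<lambda>e. ecoef a e \<cdot>\<^sub>e munit A e) (bas A)"
proof (rule elems_eqI[OF a])
  fix x i j assume ij: "i < A x" "j < A x"
  have "(\<Sum>e\<in>bas A. (ecoef a e \<cdot>\<^sub>e munit A e) x $$ (i, j)) =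
        (\<Sum>e\<in>bas A. if (x, i, j) = e then ecoef a (x, i, j) else 0)"
    using ij by (intro sum.cong) (auto simp: esmult_def munit_def)
  also have "\<dots> = a x $$ (i, j)"
    using A ij by (simp add: bas_iff ecoef_def)
  finally show "a x $$ (i, j) = esum A (\<lambda>e. ecoef a e \<cdot>\<^sub>e munit A e) (bas A) x $$ (i, j)"
    using ij by (simp add: esum_def)
qed simp

lemma div_mod_less: 
  fixes i m n :: nat assumes "i < m * n" shows "i div n < m" "i mod n < n"
  using assms by (auto simp: less_mult_imp_div_less)
    (metis mod_less_divisor mult_0_right not_less_zero zero_less_iff_neq_zero)

lemma tensor_index:
  assumes "a \<in> elems A" "b \<in> elems B" "i < A x * B y" "j < A x * B y"
  shows "(a \<otimes>\<^sub>e b) (LPair x y) $$ (i, j) =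
         a x $$ (i div B y, j div B y) * b y $$ (i mod B y, j mod B y)"
  using assms elemsD[OF assms(1)] elemsD[OF assms(2)] by (simp add: tensor_elem_def kron_def)

lemma mlex_bound:
  fixes i m k n :: nat
  assumes "i < m" "k < n" shows "i * n + k < m * n"
proof -
  have "i * n + k < Suc i * n" using assms by simp
  also have "\<dots> \<le> m * n" using assms by (intro mult_le_mono1) simp
  finally show ?thesis .
qed

lemma tcoef_tensor:
  assumes "a \<in> elems A" "b \<in> elems B" "e \<in> bas A" "f \<in> bas B"
  shows "tcoef B (a \<otimes>\<^sub>e b) (e, f) = ecoef a e * ecoef b f"
proof -
  obtain x i j y k l where e: "e = (x, i, j)" "f = (y, k, l)" by (metis prod_cases3)
  have lt: "i < A x" "j < A x" "k < B y" "l < B y" using assms e by (auto simp: bas_iff)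
  have "i * B y + k < A x * B y" "j * B y + l < A x * B y"
    using lt by (auto intro: mlex_bound)
  then show ?thesis using lt assms
    by (simp add: e tcoef_def tensor_index ecoef_def)
qed

lemma munit_index:
  "i < A x \<Longrightarrow> j < A x \<Longrightarrow> munit A e x $$ (i, j) = (if (x, i, j) = e then 1 else 0)"
  by (simp add: munit_def)

lemma munit_tensor_index:
  assumes "i < A x * B y" "j < A x * B y"
  shows "(munit A (fst ef) \<otimes>\<^sub>e munit B (snd ef)) (LPair x y) $$ (i, j) =
    (if ((x, i div B y, j div B y), (y, i mod B y, j mod B y)) = ef then 1 else 0)"
proof -
  obtain e f where ef: "ef = (e, f)" by (cases ef)
  have if_mult: "(if P then 1 else 0) * (if Q then 1 else 0) = (if P \<and> Q then 1 else 0 :: complex)" for P Q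
    by simp
  have lt: "i div B y < A x" "j div B y < A x" "i mod B y < B y" "j mod B y < B y"
    using assms div_mod_less by blast+
  show ?thesis
    unfolding tensor_index[where A = A and B = B, OF munit_elems munit_elems assms]
    by (simp only: ef fst_conv snd_conv prod.inject if_mult
        munit_index[where A = A, OF lt(1,2)] munit_index[where A = B, OF lt(3,4)])
qed

lemma eindex:
  "i < A x \<Longrightarrow> j < A x \<Longrightarrow> esum A f S x $$ (i, j) = (\<Sum>s\<in>S. f s x $$ (i, j))"
  "b \<in> elems A \<Longrightarrow> i < A x \<Longrightarrow> j < A x \<Longrightarrow> (a +\<^sub>e b) x $$ (i, j) = a x $$ (i, j) + b x $$ (i, j)"
  "a \<in> elems A \<Longrightarrow> i < A x \<Longrightarrow> j < A x \<Longrightarrow> (c \<cdot>\<^sub>e a) x $$ (i, j) = c * a x $$ (i, j)"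
  by (auto simp: esum_def eadd_def esmult_def elemsD)

lemma tensor_expand:
  assumes A: "multi_matrix A" and B: "multi_matrix B" and T: "T \<in> elems (A \<otimes>\<^sub>a B)"
  shows "T = esum (A \<otimes>\<^sub>a B) (\<lambda>ef. tcoef B T ef \<cdot>\<^sub>e (munit A (fst ef) \<otimes>\<^sub>e munit B (snd ef))) (bas A \<times> bas B)"
    (is "T = ?S")
proof (rule elems_eqI[OF T])
  fix z i j assume "i < (A \<otimes>\<^sub>a B) z" "j < (A \<otimes>\<^sub>a B) z"
  then obtain x y where z: "z = LPair x y" and ij: "i < A x * B y" "j < A x * B y"
    by (auto simp: tensor_alg_def split: label.splits)
  let ?e = "(x, i div B y, j div B y)" and ?f = "(y, i mod B y, j mod B y)"
  have "?S z $$ (i, j) = (\<Sum>ef\<in>bas A \<times> bas B. tcoef B T ef * (munit A (fst ef) \<otimes>\<^sub>e munit B (snd ef)) z $$ (i, j))"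
  proof -
    have "dim_row ((munit A (fst ef) \<otimes>\<^sub>e munit B (snd ef)) (LPair x y)) = A x * B y"
      "dim_col ((munit A (fst ef) \<otimes>\<^sub>e munit B (snd ef)) (LPair x y)) = A x * B y" for ef
      unfolding tensor_elem_def kron_def munit_def by auto
    then show ?thesis using ij
      by (simp add: esum_def esmult_def z tensor_alg_def del: split_paired_All cong: sum.cong)
  qed
  also have "\<dots> = (\<Sum>ef\<in>bas A \<times> bas B. if (?e, ?f) = ef then tcoef B T (?e, ?f) else 0)"
    using ij by (intro sum.cong refl)
      (simp add: z munit_tensor_index)
  also have "\<dots> = tcoef B T (?e, ?f)"
    using A B ij by (auto simp: bas_iff div_mod_less)
  also have "\<dots> = T z $$ (i, j)" by (simp add: tcoef_def z)
  finally show "T z $$ (i, j) = ?S z $$ (i, j)" by simp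
qed simp

lemma lin_mapsD:
  assumes "\<Phi> \<in> lin_maps A B"
  shows "a \<in> elems A \<Longrightarrow> \<Phi> a \<in> elems B"
    "a \<in> elems A \<Longrightarrow> a' \<in> elems A \<Longrightarrow> \<Phi> (a +\<^sub>e a') = \<Phi> a +\<^sub>e \<Phi> a'"
    "a \<in> elems A \<Longrightarrow> \<Phi> (c \<cdot>\<^sub>e a) = c \<cdot>\<^sub>e \<Phi> a"
    "\<Phi> \<in> extensional (elems A)"
  using assms unfolding lin_maps_def by (auto simp: PiE_def)

lemma lin_mapsI:
  assumes "\<And>a. a \<in> elems A \<Longrightarrow> F a \<in> elems B"
    "\<And>a a'. a \<in> elems A \<Longrightarrow> a' \<in> elems A \<Longrightarrow> F (a +\<^sub>e a') = F a +\<^sub>e F a'"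
    "\<And>c a. a \<in> elems A \<Longrightarrow> F (c \<cdot>\<^sub>e a) = c \<cdot>\<^sub>e F a"
  shows "(\<lambda>a\<in>elems A. F a) \<in> lin_maps A B"
  using assms unfolding lin_maps_def by auto

lemma esum_empty: "esum A f {} = ezero A"
  by (auto simp: esum_def ezero_def fun_eq_iff intro!: eq_matI)

lemma esum_insert:
  assumes "finite S" "s \<notin> S" "f s \<in> elems A"
  shows "esum A f (insert s S) = f s +\<^sub>e esum A f S"
proof (rule elems_eqI[where A = A])
  fix x i j assume "i < A x" "j < A x"
  then show "esum A f (insert s S) x $$ (i, j) = (f s +\<^sub>e esum A f S) x $$ (i, j)"
    using assms by (simp add: esum_def eadd_def elemsD)
qed (use assms in auto)

lemma lin_esum:
  assumes L: "\<Phi> \<in> lin_maps A B" and S: "finite S" and g: "\<And>s. s \<in> S \<Longrightarrow> g s \<in> elems A"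
  shows "\<Phi> (esum A g S) = esum B (\<lambda>s. \<Phi> (g s)) S"
  using S g
proof induction
  case empty
  have z: "0 \<cdot>\<^sub>e ezero A = ezero A"
    by (intro elems_eqI[where A = A]) (auto simp: esmult_def ezero_def intro!: elemsI)
  have "\<Phi> (ezero A) = 0 \<cdot>\<^sub>e \<Phi> (ezero A)" using lin_mapsD(3)[OF L, of "ezero A" 0] z by simp
  also have "\<dots> = ezero B"
  proof (rule elems_eqI[where A = B])
    have e: "\<Phi> (ezero A) \<in> elems B" using lin_mapsD(1)[OF L, of "ezero A"] by simp
    then show "0 \<cdot>\<^sub>e \<Phi> (ezero A) \<in> elems B" by simp
    fix x i j assume "i < B x" "j < B x"
    then show "(0 \<cdot>\<^sub>e \<Phi> (ezero A)) x $$ (i, j) = ezero B x $$ (i, j)"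
      using elemsD[OF e] by (simp add: esmult_def ezero_def)
  qed simp
  finally show ?case by (simp add: esum_empty)
next
  case (insert s S)
  then show ?case by (simp add: esum_insert lin_mapsD[OF L])
qed

lemma esum_cong: "(\<And>s. s \<in> S \<Longrightarrow> f s = g s) \<Longrightarrow> esum A f S = esum A g S"
  by (auto simp: esum_def fun_eq_iff intro!: eq_matI)

lemma lin_tensor_eq:
  assumes A: "multi_matrix A" and B: "multi_matrix B"
    and L: "\<Phi> \<in> lin_maps (A \<otimes>\<^sub>a B) C" "\<Psi> \<in> lin_maps (A \<otimes>\<^sub>a B) C"
    and eq: "\<And>a b. a \<in> elems A \<Longrightarrow> b \<in> elems B \<Longrightarrow> \<Phi> (a \<otimes>\<^sub>e b) = \<Psi> (a \<otimes>\<^sub>e b)"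
  shows "\<Phi> = \<Psi>"
proof (rule extensionalityI)
  fix T assume T: "T \<in> elems (A \<otimes>\<^sub>a B)"
  have *: "\<Xi> T = esum C (\<lambda>ef. tcoef B T ef \<cdot>\<^sub>e \<Xi> (munit A (fst ef) \<otimes>\<^sub>e munit B (snd ef))) (bas A \<times> bas B)"
    if "\<Xi> \<in> lin_maps (A \<otimes>\<^sub>a B) C" for \<Xi>
    apply (subst tensor_expand[OF A B T])
    using A B lin_mapsD(3)[OF that] by (subst lin_esum[OF that]) (auto intro!: esum_cong)
  show "\<Phi> T = \<Psi> T" unfolding *[OF L(1)] *[OF L(2)] using eq by (auto intro!: esum_cong)
qed (use L in \<open>auto dest: lin_mapsD(4)\<close>)

lemma bilinear_mapD:
  assumes "bilinear_map A B C f" "a \<in> elems A" "b \<in> elems B"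
  shows "(\<lambda>b\<in>elems B. f a b) \<in> lin_maps B C" "(\<lambda>a\<in>elems A. f a b) \<in> lin_maps A C" "f a b \<in> elems C"
  using assms lin_mapsD(1)[of "\<lambda>b\<in>elems B. f a b" B C b] unfolding bilinear_map_def by auto

lemma tensor_lift_unique:
  assumes A: "multi_matrix A" and B: "multi_matrix B" and f: "bilinear_map A B C f"
  shows "\<exists>!\<Psi>. \<Psi> \<in> lin_maps (A \<otimes>\<^sub>a B) C \<and>
           (\<forall>a\<in>elems A. \<forall>b\<in>elems B. \<Psi> (a \<otimes>\<^sub>e b) = f a b)"
proof (rule ex_ex1I)
  let ?F = "\<lambda>T. esum C (\<lambda>ef. tcoef B T ef \<cdot>\<^sub>e f (munit A (fst ef)) (munit B (snd ef))) (bas A \<times> bas B)"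
  have fe: "f a b \<in> elems C" if "a \<in> elems A" "b \<in> elems B" for a b
    using bilinear_mapD(3)[OF f that] .
  have lt: "i * B y + k < A x * B y" if "i < A x" "k < B y" for i k x y
    using that by (rule mlex_bound)
  have tc: "tcoef B (S +\<^sub>e T) ef = tcoef B S ef + tcoef B T ef" "tcoef B (c \<cdot>\<^sub>e T) ef = c * tcoef B T ef"
    if "S \<in> elems (A \<otimes>\<^sub>a B)" "T \<in> elems (A \<otimes>\<^sub>a B)" "ef \<in> bas A \<times> bas B" for S T ef c
    using that elemsD[OF that(1)] elemsD[OF that(2)]
    by (auto simp: tcoef_def eadd_def esmult_def bas_iff lt tensor_alg_def split: prod.splits)
  have lin: "(\<lambda>T\<in>elems (A \<otimes>\<^sub>a B). ?F T) \<in> lin_maps (A \<otimes>\<^sub>a B) C"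
  proof (rule lin_mapsI)
    fix S T assume ST: "S \<in> elems (A \<otimes>\<^sub>a B)" "T \<in> elems (A \<otimes>\<^sub>a B)"
    show "?F (S +\<^sub>e T) = ?F S +\<^sub>e ?F T"
    proof (rule elems_eqI[where A = C])
      fix x i j assume "i < C x" "j < C x"
      then show "?F (S +\<^sub>e T) x $$ (i, j) = (?F S +\<^sub>e ?F T) x $$ (i, j)"
        by (simp add: eindex[of _ C] fe tc(1)[OF ST] distrib_right sum.distrib del: split_paired_all cong: sum.cong)
    qed auto
  next
    fix c T assume T: "T \<in> elems (A \<otimes>\<^sub>a B)"
    show "?F (c \<cdot>\<^sub>e T) = c \<cdot>\<^sub>e ?F T"
    proof (rule elems_eqI[where A = C])
      fix x i j assume "i < C x" "j < C x"
      then show "?F (c \<cdot>\<^sub>e T) x $$ (i, j) = (c \<cdot>\<^sub>e ?F T) x $$ (i, j)"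
        by (simp add: eindex[of _ C] fe tc(2)[OF T T] sum_distrib_left mult.assoc cong: sum.cong)
    qed auto
  qed auto
  have val: "?F (a \<otimes>\<^sub>e b) = f a b" if ab: "a \<in> elems A" "b \<in> elems B" for a b
  proof -
    have 1: "f a b = esum C (\<lambda>e. ecoef a e \<cdot>\<^sub>e f (munit A e) b) (bas A)" if "b \<in> elems B" for b
    proof -
      note L = bilinear_mapD(2)[OF f ab(1) that]
      have "f a b = (\<lambda>a\<in>elems A. f a b) (esum A (\<lambda>e. ecoef a e \<cdot>\<^sub>e munit A e) (bas A))"
        using ab(1) by (simp flip: expand[OF A ab(1)])
      then show ?thesis using A lin_mapsD(3)[OF L, of "munit A _"]
        by (subst (asm) lin_esum[OF L]) (auto intro!: esum_cong)
    qed
    have 2: "f a b = esum C (\<lambda>e. ecoef b e \<cdot>\<^sub>e f a (munit B e)) (bas B)" if "a \<in> elems A" for a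
    proof -
      note L = bilinear_mapD(1)[OF f that ab(2)]
      have "f a b = (\<lambda>b\<in>elems B. f a b) (esum B (\<lambda>e. ecoef b e \<cdot>\<^sub>e munit B e) (bas B))"
        using ab(2) by (simp flip: expand[OF B ab(2)])
      then show ?thesis using B lin_mapsD(3)[OF L, of "munit B _"]
        by (subst (asm) lin_esum[OF L]) (auto intro!: esum_cong)
    qed
    show ?thesis
    proof (rule elems_eqI[where A = C])
      fix x i j assume ij: "i < C x" "j < C x"
      have i2: "f (munit A e) b x $$ (i, j) = (\<Sum>e'\<in>bas B. ecoef b e' * f (munit A e) (munit B e') x $$ (i, j))" for e
        by (subst 2) (use ij fe ab in \<open>simp_all add: eindex[of _ C]\<close>)
      have "f a b x $$ (i, j) = (\<Sum>e\<in>bas A. ecoef a e * f (munit A e) b x $$ (i, j))"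
        by (subst 1) (use ij fe ab in \<open>simp_all add: eindex[of _ C]\<close>)
      also have "\<dots> = (\<Sum>ef\<in>bas A \<times> bas B. ecoef a (fst ef) * ecoef b (snd ef) * f (munit A (fst ef)) (munit B (snd ef)) x $$ (i, j))"
        unfolding i2 by (simp add: sum_distrib_left sum.cartesian_product mult.assoc split_def)
      also have "\<dots> = ?F (a \<otimes>\<^sub>e b) x $$ (i, j)"
        using ij by (auto simp: eindex[of _ C] fe tcoef_tensor[OF ab] intro!: sum.cong)
      finally show "?F (a \<otimes>\<^sub>e b) x $$ (i, j) = f a b x $$ (i, j)" by simp
    qed (use fe ab in auto)
  qed
  show "\<exists>\<Psi>. \<Psi> \<in> lin_maps (A \<otimes>\<^sub>a B) C \<and> (\<forall>a\<in>elems A. \<forall>b\<in>elems B. \<Psi> (a \<otimes>\<^sub>e b) = f a b)"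
    using lin val by (intro exI[of _ "\<lambda>T\<in>elems (A \<otimes>\<^sub>a B). ?F T"]) auto
qed (auto intro!: lin_tensor_eq[OF A B])

lemma tensor_lift:
  assumes "multi_matrix A" "multi_matrix B" "bilinear_map A B C f"
  shows "tensor_lift A B C f \<in> lin_maps (A \<otimes>\<^sub>a B) C"
    and "a \<in> elems A \<Longrightarrow> b \<in> elems B \<Longrightarrow> tensor_lift A B C f (a \<otimes>\<^sub>e b) = f a b"
  using theI'[OF tensor_lift_unique[OF assms]] unfolding tensor_lift_def by auto


lemma eadj_tensor:
  assumes "a \<in> elems A" "b \<in> elems B"
  shows "eadj (a \<otimes>\<^sub>e b) = eadj a \<otimes>\<^sub>e eadj b"
proof (rule elems_eqI[where A = "A \<otimes>\<^sub>a B"])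
  fix z i j assume "i < (A \<otimes>\<^sub>a B) z" "j < (A \<otimes>\<^sub>a B) z"
  then obtain x y where z: "z = LPair x y" and ij: "i < A x * B y" "j < A x * B y"
    by (auto simp: tensor_alg_def split: label.splits)
  show "eadj (a \<otimes>\<^sub>e b) z $$ (i, j) = (eadj a \<otimes>\<^sub>e eadj b) z $$ (i, j)"
    using assms ij elemsD[OF assms(1)] elemsD[OF assms(2)]
      elemsD[OF tensor_elems[OF assms], of "LPair x y"]
    by (simp add: z eadj_def tensor_alg_def tensor_elem_def kron_def div_mod_less)
qed (use assms in auto)

lemma eadj_simps:
  assumes "a \<in> elems A" "b \<in> elems A"
  shows "eadj (eadj a) = a" "eadj (a +\<^sub>e b) = eadj a +\<^sub>e eadj b"
proof -
  note d = elemsD[OF assms(1)] elemsD[OF assms(2)]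
  show "eadj (eadj a) = a" using d by (auto simp: eadj_def fun_eq_iff intro!: eq_matI)
  show "eadj (a +\<^sub>e b) = eadj a +\<^sub>e eadj b" using d by (auto simp: eadj_def eadd_def fun_eq_iff intro!: eq_matI)
qed

lemma eadj_smult: "a \<in> elems A \<Longrightarrow> eadj (c \<cdot>\<^sub>e a) = cnj c \<cdot>\<^sub>e eadj a"
  by (auto simp: eadj_def esmult_def fun_eq_iff elemsD intro!: eq_matI)

lemma tensor_bilinear:
  "a \<in> elems A \<Longrightarrow> a' \<in> elems A \<Longrightarrow> b \<in> elems B \<Longrightarrow> (a +\<^sub>e a') \<otimes>\<^sub>e b = a \<otimes>\<^sub>e b +\<^sub>e a' \<otimes>\<^sub>e b"
  "a \<in> elems A \<Longrightarrow> b \<in> elems B \<Longrightarrow> b' \<in> elems B \<Longrightarrow> a \<otimes>\<^sub>e (b +\<^sub>e b') = a \<otimes>\<^sub>e b +\<^sub>e a \<otimes>\<^sub>e b'"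
  "a \<in> elems A \<Longrightarrow> b \<in> elems B \<Longrightarrow> (c \<cdot>\<^sub>e a) \<otimes>\<^sub>e b = c \<cdot>\<^sub>e (a \<otimes>\<^sub>e b)"
  "a \<in> elems A \<Longrightarrow> b \<in> elems B \<Longrightarrow> a \<otimes>\<^sub>e (c \<cdot>\<^sub>e b) = c \<cdot>\<^sub>e (a \<otimes>\<^sub>e b)"
  by (auto simp: tensor_elem_def kron_def eadd_def esmult_def fun_eq_iff algebra_simps elemsD
      div_mod_less split: label.splits intro!: eq_matI)

lemma bilinear_swap: "bilinear_map B A (A \<otimes>\<^sub>a B) (\<lambda>b a. a \<otimes>\<^sub>e b)"
  unfolding bilinear_map_def
  by (auto intro!: lin_mapsI simp: tensor_bilinear(1)[of _ A _ _ B] tensor_bilinear(2-4)[of _ A _ B])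

lemma time_reversal_unique:
  assumes A: "multi_matrix A" and B: "multi_matrix B"
  shows "\<exists>!\<tau>. \<tau> \<in> conj_lin_maps (B \<otimes>\<^sub>a A) (A \<otimes>\<^sub>a B) \<and>
           (\<forall>b\<in>elems B. \<forall>a\<in>elems A. \<tau> (b \<otimes>\<^sub>e a) = eadj a \<otimes>\<^sub>e eadj b)"
proof (rule ex_ex1I)
  note S = tensor_lift[OF B A bilinear_swap]
  let ?S = "tensor_lift B A (A \<otimes>\<^sub>a B) (\<lambda>b a. a \<otimes>\<^sub>e b)"
  let ?t = "\<lambda>T\<in>elems (B \<otimes>\<^sub>a A). eadj (?S T)"
  have "?t \<in> conj_lin_maps (B \<otimes>\<^sub>a A) (A \<otimes>\<^sub>a B)"
    unfolding conj_lin_maps_def using lin_mapsD[OF S(1)] by (auto simp: eadj_simps(2)[of _ "A \<otimes>\<^sub>a B"] eadj_smult[of _ "A \<otimes>\<^sub>a B"])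
  moreover have "?t (b \<otimes>\<^sub>e a) = eadj a \<otimes>\<^sub>e eadj b" if "b \<in> elems B" "a \<in> elems A" for a b
    using that by (simp add: S eadj_tensor[of _ A _ B])
  ultimately show "\<exists>\<tau>. \<tau> \<in> conj_lin_maps (B \<otimes>\<^sub>a A) (A \<otimes>\<^sub>a B) \<and>
           (\<forall>b\<in>elems B. \<forall>a\<in>elems A. \<tau> (b \<otimes>\<^sub>e a) = eadj a \<otimes>\<^sub>e eadj b)" by blast
next
  fix s t
  assume st: "s \<in> conj_lin_maps (B \<otimes>\<^sub>a A) (A \<otimes>\<^sub>a B) \<and> (\<forall>b\<in>elems B. \<forall>a\<in>elems A. s (b \<otimes>\<^sub>e a) = eadj a \<otimes>\<^sub>e eadj b)"
    "t \<in> conj_lin_maps (B \<otimes>\<^sub>a A) (A \<otimes>\<^sub>a B) \<and> (\<forall>b\<in>elems B. \<forall>a\<in>elems A. t (b \<otimes>\<^sub>e a) = eadj a \<otimes>\<^sub>e eadj b)"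
  have *: "(\<lambda>T\<in>elems (B \<otimes>\<^sub>a A). eadj (s T)) \<in> lin_maps (B \<otimes>\<^sub>a A) (A \<otimes>\<^sub>a B)"
    if "s \<in> conj_lin_maps (B \<otimes>\<^sub>a A) (A \<otimes>\<^sub>a B)" for s
  proof -
    have "s T \<in> elems (A \<otimes>\<^sub>a B)" if "T \<in> elems (B \<otimes>\<^sub>a A)" for T
      using that \<open>s \<in> _\<close> by (auto simp: conj_lin_maps_def)
    then show ?thesis using that
      by (auto intro!: lin_mapsI simp: conj_lin_maps_def eadj_simps(2)[of _ "A \<otimes>\<^sub>a B"] eadj_smult[of _ "A \<otimes>\<^sub>a B"] PiE_mem)
  qed
  have eq: "(\<lambda>T\<in>elems (B \<otimes>\<^sub>a A). eadj (s T)) = (\<lambda>T\<in>elems (B \<otimes>\<^sub>a A). eadj (t T))"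
    by (rule lin_tensor_eq[OF B A *[of s] *[of t]]) (use st in auto)
  show "s = t"
  proof (rule extensionalityI)
    fix T assume T: "T \<in> elems (B \<otimes>\<^sub>a A)"
    then have "eadj (s T) = eadj (t T)" using fun_cong[OF eq, of T] by simp
    moreover have "s T \<in> elems (A \<otimes>\<^sub>a B)" "t T \<in> elems (A \<otimes>\<^sub>a B)"
      using T st by (auto simp: conj_lin_maps_def)
    ultimately show "s T = t T" by (metis eadj_simps(1))
  qed (use st in \<open>auto simp: conj_lin_maps_def PiE_def\<close>)
qed

lemma etr_lin:
  assumes "a \<in> elems A" "b \<in> elems A"
  shows "etr A (a +\<^sub>e b) = etr A a + etr A b" "etr A (c \<cdot>\<^sub>e a) = c * etr A a"
  using elemsD[OF assms(1)] elemsD[OF assms(2)]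
  by (auto simp: etr_def eadd_def esmult_def sum.distrib sum_distrib_left intro!: sum.cong)

lemma emult_lin:
  assumes "a \<in> elems A" "b \<in> elems A" "d \<in> elems A"
  shows "(a +\<^sub>e b) *\<^sub>e d = a *\<^sub>e d +\<^sub>e b *\<^sub>e d" "d *\<^sub>e (a +\<^sub>e b) = d *\<^sub>e a +\<^sub>e d *\<^sub>e b"
    "(c \<cdot>\<^sub>e a) *\<^sub>e d = c \<cdot>\<^sub>e (a *\<^sub>e d)" "d *\<^sub>e (c \<cdot>\<^sub>e a) = c \<cdot>\<^sub>e (d *\<^sub>e a)"
proof -
  have m: "a x \<in> carrier_mat (A x) (A x)" "b x \<in> carrier_mat (A x) (A x)" "d x \<in> carrier_mat (A x) (A x)" for x
    using assms by (auto simp: elems_def)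
  show "(a +\<^sub>e b) *\<^sub>e d = a *\<^sub>e d +\<^sub>e b *\<^sub>e d" "d *\<^sub>e (a +\<^sub>e b) = d *\<^sub>e a +\<^sub>e d *\<^sub>e b"
    "(c \<cdot>\<^sub>e a) *\<^sub>e d = c \<cdot>\<^sub>e (a *\<^sub>e d)" "d *\<^sub>e (c \<cdot>\<^sub>e a) = c \<cdot>\<^sub>e (d *\<^sub>e a)"
    unfolding emult_def eadd_def esmult_def fun_eq_iff
    using add_mult_distrib_mat[OF m(1) m(2) m(3)] mult_add_distrib_mat[OF m(3) m(1) m(2)]
      mult_smult_assoc_mat[OF m(1) m(3)] mult_smult_distrib[OF m(3) m(1)] by auto
qed

lemma etr_smult: "a \<in> elems A \<Longrightarrow> etr A (c \<cdot>\<^sub>e a) = c * etr A a"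
  using etr_lin(2) by blast

lemma emult_smult: "a \<in> elems A \<Longrightarrow> d \<in> elems A \<Longrightarrow> d *\<^sub>e (c \<cdot>\<^sub>e a) = c \<cdot>\<^sub>e (d *\<^sub>e a)"
  using emult_lin(4) by blast

lemma hs_pairing:
  assumes "a \<in> elems A" "b \<in> elems A"
  shows "etr A (eadj a *\<^sub>e b) = (\<Sum>x | A x \<noteq> 0. \<Sum>j<A x. \<Sum>i<A x. cnj (a x $$ (i, j)) * b x $$ (i, j))"
  using elemsD[OF assms(1)] elemsD[OF assms(2)]
  by (auto simp: etr_def emult_def eadj_def scalar_prod_def atLeast0LessThan intro!: sum.cong)

lemma hs_munit:
  assumes A: "multi_matrix A" and b: "b \<in> elems A" and e: "e \<in> bas A"
  shows "etr A (eadj (munit A e) *\<^sub>e b) = ecoef b e"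
proof -
  obtain x i j where e': "e = (x, i, j)" by (metis prod_cases3)
  have lt: "i < A x" "j < A x" using e e' by (auto simp: bas_iff)
  have fin: "finite {x. A x \<noteq> 0}" using A by (simp add: multi_matrix_def)
  have "etr A (eadj (munit A e) *\<^sub>e b) =
    (\<Sum>x' | A x' \<noteq> 0. if x' = x then (\<Sum>j'<A x'. if j' = j then (\<Sum>i'<A x'. if i' = i then b x $$ (i, j) else 0) else 0) else 0)"
    unfolding hs_pairing[OF munit_elems b]
  proof (intro sum.cong refl)
    fix x' assume "x' \<in> {x. A x \<noteq> 0}"
    have "(\<Sum>j'<A x. \<Sum>i'<A x. cnj (munit A e x $$ (i', j')) * b x $$ (i', j')) =
      (\<Sum>j'<A x. if j' = j then (\<Sum>i'<A x. if i' = i then b x $$ (i, j) else 0) else 0)"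
    proof (rule sum.cong[OF refl])
      fix j' assume "j' \<in> {..<A x}"
      then have "(\<Sum>i'<A x. cnj (munit A e x $$ (i', j')) * b x $$ (i', j')) =
        (\<Sum>i'<A x. if j' = j then (if i' = i then b x $$ (i, j) else 0) else 0)"
        by (intro sum.cong) (auto simp: munit_def e')
      then show "(\<Sum>i'<A x. cnj (munit A e x $$ (i', j')) * b x $$ (i', j')) =
        (if j' = j then (\<Sum>i'<A x. if i' = i then b x $$ (i, j) else 0) else 0)" by simp
    qed
    then show "(\<Sum>j'<A x'. \<Sum>i'<A x'. cnj (munit A e x' $$ (i', j')) * b x' $$ (i', j')) =
      (if x' = x then (\<Sum>j'<A x'. if j' = j then (\<Sum>i'<A x'. if i' = i then b x $$ (i, j) else 0) else 0) else 0)"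
      by (auto simp: munit_def e')
  qed
  also have "\<dots> = b x $$ (i, j)" using fin lt by simp
  finally show ?thesis by (simp add: e' ecoef_def)
qed

lemma etr_adj_esum:
  assumes "finite S" "\<And>s. s \<in> S \<Longrightarrow> f s \<in> elems C" "v \<in> elems C"
  shows "etr C (eadj v *\<^sub>e esum C f S) = (\<Sum>s\<in>S. etr C (eadj v *\<^sub>e f s))"
  using assms
proof induction
  case empty
  then show ?case by (simp add: hs_pairing[OF _ elems_closed(5)]) (simp add: esum_def)
next
  case (insert s S)
  then show ?case by (simp add: esum_insert emult_lin(2)[of _ C] etr_lin(1)[of _ C])
qed

lemma hs_adjoint_unique:
  assumes A: "multi_matrix A" and B: "multi_matrix B" and L: "\<Phi> \<in> lin_maps A B"
  shows "\<exists>!\<Psi>. \<Psi> \<in> lin_maps B A \<and>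
     (\<forall>a\<in>elems A. \<forall>b\<in>elems B. etr B (eadj (\<Phi> a) *\<^sub>e b) = etr A (eadj a *\<^sub>e \<Psi> b))"
proof (rule ex_ex1I)
  let ?c = "\<lambda>b e. etr B (eadj (\<Phi> (munit A e)) *\<^sub>e b)"
  let ?F = "\<lambda>b x. mat (A x) (A x) (\<lambda>(i, j). ?c b (x, i, j))"
  have F: "?F b \<in> elems A" for b by (auto intro!: elemsI)
  note Pe = lin_mapsD(1)[OF L]
  have lin: "(\<lambda>b\<in>elems B. ?F b) \<in> lin_maps B A"
  proof (rule lin_mapsI)
    fix b b' assume b: "b \<in> elems B" "b' \<in> elems B"
    show "?F (b +\<^sub>e b') = ?F b +\<^sub>e ?F b'"
    proof (rule elems_eqI[where A = A])
      fix x i j assume "i < A x" "j < A x"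
      then show "?F (b +\<^sub>e b') x $$ (i, j) = (?F b +\<^sub>e ?F b') x $$ (i, j)"
        using b Pe[OF munit_elems]
        by (simp add: eindex(2)[OF F] emult_lin(2)[of _ B] etr_lin(1)[of _ B])
    qed (simp_all add: F)
  next
    fix c b assume b: "b \<in> elems B"
    show "?F (c \<cdot>\<^sub>e b) = c \<cdot>\<^sub>e ?F b"
    proof (rule elems_eqI[where A = A])
      fix x i j assume "i < A x" "j < A x"
      then show "?F (c \<cdot>\<^sub>e b) x $$ (i, j) = (c \<cdot>\<^sub>e ?F b) x $$ (i, j)"
        using b Pe[OF munit_elems]
        by (simp add: eindex(3)[OF F] emult_smult[of _ B] etr_smult[of _ B])
    qed (simp_all add: F)
  qed (rule F)
  have "etr B (eadj (\<Phi> a) *\<^sub>e b) = etr A (eadj a *\<^sub>e ?F b)" if a: "a \<in> elems A" and b: "b \<in> elems B" for a b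
  proof -
    have conj: "cnj (etr C (eadj u *\<^sub>e v)) = etr C (eadj v *\<^sub>e u)" if "u \<in> elems C" "v \<in> elems C" for C :: "'a alg" and u v
      using that by (simp add: hs_pairing mult.commute)
    have P: "\<Phi> a = esum B (\<lambda>e. ecoef a e \<cdot>\<^sub>e \<Phi> (munit A e)) (bas A)"
      using expand[OF A a] lin_esum[OF L finite_bas[OF A], of "\<lambda>e. ecoef a e \<cdot>\<^sub>e munit A e"]
      by (simp add: lin_mapsD(3)[OF L])
    have "cnj (etr B (eadj (\<Phi> a) *\<^sub>e b)) = etr B (eadj b *\<^sub>e \<Phi> a)" using conj Pe a b by blast
    also have "\<dots> = (\<Sum>e\<in>bas A. ecoef a e * etr B (eadj b *\<^sub>e \<Phi> (munit A e)))"
      using b A Pe by (subst P, subst etr_adj_esum)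
       (auto simp: emult_smult[of _ B] etr_smult[of _ B] intro!: sum.cong)
    also have "\<dots> = (\<Sum>e\<in>bas A. ecoef a e * cnj (?c b e))"
      using b Pe by (intro sum.cong refl) (simp add: conj)
    also have "\<dots> = (\<Sum>e\<in>bas A. ecoef a e * etr A (eadj (?F b) *\<^sub>e munit A e))"
    proof (intro sum.cong refl)
      fix e assume e: "e \<in> bas A"
      have "etr A (eadj (?F b) *\<^sub>e munit A e) = cnj (ecoef (?F b) e)"
        unfolding hs_munit[OF A F e, symmetric] by (rule conj[OF munit_elems F, symmetric])
      also have "ecoef (?F b) e = ?c b e"
        using e by (cases e) (auto simp: ecoef_def bas_iff)
      finally show "ecoef a e * cnj (?c b e) = ecoef a e * etr A (eadj (?F b) *\<^sub>e munit A e)"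
        by (rule arg_cong[OF sym])
    qed
    also have "\<dots> = etr A (eadj (?F b) *\<^sub>e a)"
      using A F by (subst (2) expand[OF A a], subst etr_adj_esum)
       (auto simp: emult_smult[of _ A] etr_smult[of _ A] intro!: sum.cong)
    also have "\<dots> = cnj (etr A (eadj a *\<^sub>e ?F b))" using conj[OF a F] by simp
    finally show ?thesis by (simp only: complex_cnj_cancel_iff)
  qed
  then show "\<exists>\<Psi>. \<Psi> \<in> lin_maps B A \<and>
     (\<forall>a\<in>elems A. \<forall>b\<in>elems B. etr B (eadj (\<Phi> a) *\<^sub>e b) = etr A (eadj a *\<^sub>e \<Psi> b))"
    using lin by (intro exI[of _ "\<lambda>b\<in>elems B. ?F b"] conjI ballI) (simp_all only: restrict_apply')
next
  fix s t
  assume st: "s \<in> lin_maps B A \<and> (\<forall>a\<in>elems A. \<forall>b\<in>elems B. etr B (eadj (\<Phi> a) *\<^sub>e b) = etr A (eadj a *\<^sub>e s b))"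
    "t \<in> lin_maps B A \<and> (\<forall>a\<in>elems A. \<forall>b\<in>elems B. etr B (eadj (\<Phi> a) *\<^sub>e b) = etr A (eadj a *\<^sub>e t b))"
  show "s = t"
  proof (rule extensionalityI)
    fix b assume b: "b \<in> elems B"
    have sb: "s b \<in> elems A" "t b \<in> elems A" using st b by (auto dest: lin_mapsD(1))
    show "s b = t b"
    proof (rule elems_eqI[OF sb])
      fix x i j assume "i < A x" "j < A x"
      then have e: "(x, i, j) \<in> bas A" by (simp add: bas_iff)
      have "ecoef (s b) (x, i, j) = ecoef (t b) (x, i, j)"
        unfolding hs_munit[OF A sb(1) e, symmetric] hs_munit[OF A sb(2) e, symmetric]
        using bspec[OF bspec[OF conjunct2[OF st(1)] munit_elems] b, of "(x, i, j)"]
          bspec[OF bspec[OF conjunct2[OF st(2)] munit_elems] b, of "(x, i, j)"] by (rule trans[OF sym])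
      then show "s b x $$ (i, j) = t b x $$ (i, j)" by (simp add: ecoef_def)
    qed
  qed (use st in \<open>auto dest: lin_mapsD(4)\<close>)
qed

lemma bilinear_instances:
  shows "bilinear_map A A A (\<lambda>a b. a *\<^sub>e b)"
    and "bilinear_map A B B (\<lambda>a b. etr A a \<cdot>\<^sub>e b)"
    and "bilinear_map A B A (\<lambda>a b. etr B b \<cdot>\<^sub>e a)"
    and "\<Phi> \<in> lin_maps A B \<Longrightarrow> bilinear_map C A (C \<otimes>\<^sub>a B) (\<lambda>c a. c \<otimes>\<^sub>e \<Phi> a)"
proof -
  have s: "(c + d) \<cdot>\<^sub>e a = c \<cdot>\<^sub>e a +\<^sub>e d \<cdot>\<^sub>e a" "c \<cdot>\<^sub>e (a +\<^sub>e b) = c \<cdot>\<^sub>e a +\<^sub>e c \<cdot>\<^sub>e b"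
    "c \<cdot>\<^sub>e d \<cdot>\<^sub>e a = (c * d) \<cdot>\<^sub>e a" if "a \<in> elems A" "b \<in> elems A" for A :: "'x alg" and a b c d
    using elemsD[OF that(1)] elemsD[OF that(2)]
    by (auto simp: esmult_def eadd_def fun_eq_iff algebra_simps intro!: eq_matI)
  show "bilinear_map A A A (\<lambda>a b. a *\<^sub>e b)"
    unfolding bilinear_map_def by (auto intro!: lin_mapsI simp: emult_lin[of _ A])
  show "bilinear_map A B B (\<lambda>a b. etr A a \<cdot>\<^sub>e b)"
    unfolding bilinear_map_def by (auto intro!: lin_mapsI simp: etr_lin[of _ A] s[of _ B] mult.commute)
  show "bilinear_map A B A (\<lambda>a b. etr B b \<cdot>\<^sub>e a)"
    unfolding bilinear_map_def by (auto intro!: lin_mapsI simp: etr_lin[of _ B] s[of _ A] mult.commute)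
  show "bilinear_map C A (C \<otimes>\<^sub>a B) (\<lambda>c a. c \<otimes>\<^sub>e \<Phi> a)" if "\<Phi> \<in> lin_maps A B"
    unfolding bilinear_map_def using lin_mapsD[OF that]
    by (auto intro!: lin_mapsI simp: tensor_bilinear(1)[of _ C _ _ B] tensor_bilinear(2-4)[of _ C _ B])
qed

corollary id_tensor:
  assumes "multi_matrix A" "multi_matrix C" "\<Phi> \<in> lin_maps A B"
  shows "id_tensor C A B \<Phi> \<in> lin_maps (C \<otimes>\<^sub>a A) (C \<otimes>\<^sub>a B)"
    and "c \<in> elems C \<Longrightarrow> a \<in> elems A \<Longrightarrow> id_tensor C A B \<Phi> (c \<otimes>\<^sub>e a) = c \<otimes>\<^sub>e \<Phi> a"
  unfolding id_tensor_def
  by (fact tensor_lift[OF assms(2,1) bilinear_instances(4)[OF assms(3), of C]])+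

corollary partial_traces:
  assumes "multi_matrix A" "multi_matrix B"
  shows "ptr_fst A B \<in> lin_maps (A \<otimes>\<^sub>a B) B" "ptr_snd A B \<in> lin_maps (A \<otimes>\<^sub>a B) A"
    and "a \<in> elems A \<Longrightarrow> b \<in> elems B \<Longrightarrow> ptr_fst A B (a \<otimes>\<^sub>e b) = etr A a \<cdot>\<^sub>e b"
    and "a \<in> elems A \<Longrightarrow> b \<in> elems B \<Longrightarrow> ptr_snd A B (a \<otimes>\<^sub>e b) = etr B b \<cdot>\<^sub>e a"
  unfolding ptr_fst_def ptr_snd_def
  by (fact tensor_lift[OF assms bilinear_instances(2)[of A B]] tensor_lift[OF assms bilinear_instances(3)[of A B]])+

corollary mult_map:
  assumes "multi_matrix A"
  shows "mult_map A \<in> lin_maps (A \<otimes>\<^sub>a A) A"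
    and "a \<in> elems A \<Longrightarrow> b \<in> elems A \<Longrightarrow> mult_map A (a \<otimes>\<^sub>e b) = a *\<^sub>e b"
  unfolding mult_map_def by (fact tensor_lift[OF assms assms bilinear_instances(1)[of A]])+

corollary hs_adjoint:
  assumes "multi_matrix A" "multi_matrix B" "\<Phi> \<in> lin_maps A B"
  shows "hs_adjoint A B \<Phi> \<in> lin_maps B A"
    and "a \<in> elems A \<Longrightarrow> b \<in> elems B \<Longrightarrow>
      etr B (eadj (\<Phi> a) *\<^sub>e b) = etr A (eadj a *\<^sub>e hs_adjoint A B \<Phi> b)"
  using theI'[OF hs_adjoint_unique[OF assms]] unfolding hs_adjoint_def by blast+

corollary time_reversal:
  assumes "multi_matrix A" "multi_matrix B"
  shows "time_reversal B A \<in> conj_lin_maps (B \<otimes>\<^sub>a A) (A \<otimes>\<^sub>a B)"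
    and "b \<in> elems B \<Longrightarrow> a \<in> elems A \<Longrightarrow> time_reversal B A (b \<otimes>\<^sub>e a) = eadj a \<otimes>\<^sub>e eadj b"
  using theI'[OF time_reversal_unique[OF assms]] unfolding time_reversal_def by blast+

end

theory Submission
  imports Defs
begin

text \<open>
  Both sides of the Bayes equation are governed by the classical limit axiom.  The channel state of
  the partial trace onto \<open>\<complex>\<^sup>X\<close> is the central projection \<open>\<Sum>\<^sub>x 1 \<otimes> \<delta>\<^sub>x \<otimes> \<delta>\<^sub>x\<close>, and for a channel \<open>\<Psi>\<close> out of
  \<open>\<complex>\<^sup>X\<close> and a state \<open>\<sigma>\<close> of \<open>\<complex>\<^sup>X\<close> the element \<open>\<sigma> \<otimes> 1\<close> has scalar blocks; so both commutators vanish.  The states over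
  time are then \<open>\<Sum>\<^sub>x \<rho>\<^sub>x \<otimes> \<delta>\<^sub>x \<otimes> \<delta>\<^sub>x\<close> and \<open>\<Sum>\<^sub>x \<sigma>\<^sub>x \<delta>\<^sub>x \<otimes> \<Psi>(\<delta>\<^sub>x)\<close>, with \<open>\<sigma>\<^sub>x = tr \<rho>\<^sub>x > 0\<close>, and comparing
  coefficients determines \<open>\<Psi>(\<delta>\<^sub>x)\<close>.  That the resulting \<open>\<Psi>\<close> and the partial trace are completely
  positive is seen from factorizations of the blocks as Gram matrices.
\<close>

section \<open>Positive elements\<close>

text \<open>
  A positive element is required to have a square factor \<open>c\<close> in \<open>c\<^sup>\<dagger>c\<close>, whereas sums of positive
  elements come with a rectangular one.  The induction splits off column \<open>n\<close> of \<open>f\<close> by one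
  Gram-Schmidt step.
\<close>

lemma gram_square:
  fixes f :: "'k \<Rightarrow> nat \<Rightarrow> complex"
  assumes S: "finite S"
  shows "\<exists>c. \<forall>i<n. \<forall>j<n. (\<Sum>k\<in>S. cnj (f k i) * f k j) = (\<Sum>k<n. cnj (c k i) * c k j)"
proof (induction n arbitrary: f)
  case 0
  then show ?case by simp
next
  case (Suc n)
  define G where "G i j = (\<Sum>k\<in>S. cnj (f k i) * f k j)" for i j
  define d where "d = (\<Sum>k\<in>S. (cmod (f k n))\<^sup>2)"
  have Gnn: "G n n = of_real d"
    unfolding G_def d_def by (simp add: complex_norm_square mult.commute del: of_real_power)
  have d0: "d \<ge> 0" unfolding d_def by (simp add: sum_nonneg)
  have herm: "cnj (G i j) = G j i" for i j
    unfolding G_def by (simp add: mult.commute)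
  have GD: "G i n = 0 \<and> G n i = 0" if "d = 0" for i
  proof -
    have "\<forall>k\<in>S. f k n = 0" using that S unfolding d_def by (simp add: sum_nonneg_eq_0_iff)
    then show ?thesis unfolding G_def by simp
  qed
  \<comment> \<open>Removes from column \<open>i\<close> of \<open>f\<close> its component along
    column \<open>n\<close>; the Gram matrix of what remains is the Schur complement of the entry
    \<open>G n n\<close>.\<close>
  define f' where "f' k i = f k i - f k n * G n i / of_real d" for k i
  obtain c where c: "\<And>i j. i < n \<Longrightarrow> j < n \<Longrightarrow>
      (\<Sum>k\<in>S. cnj (f' k i) * f' k j) = (\<Sum>k<n. cnj (c k i) * c k j)"
    using Suc.IH[of f'] by blast
  \<comment> \<open>Division by \<open>d = 0\<close> is harmless: column \<open>n\<close> of \<open>f\<close> then vanishes.\<close>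
  have f': "(\<Sum>k\<in>S. cnj (f' k i) * f' k j) = G i j - G i n * G n j / of_real d" for i j
  proof -
    have "(\<Sum>k\<in>S. cnj (f' k i) * f' k j) =
        (\<Sum>k\<in>S. cnj (f k i) * f k j - cnj (f k i) * f k n * (G n j / of_real d)
           - cnj (f k n) * f k j * (G i n / of_real d)
           + cnj (f k n) * f k n * (G i n * G n j / (of_real d * of_real d)))"
      unfolding f'_def
      by (intro sum.cong refl) (simp add: herm algebra_simps)
    also have "\<dots> = G i j - G i n * (G n j / of_real d) - G n j * (G i n / of_real d)
           + G n n * (G i n * G n j / (of_real d * of_real d))"
      unfolding G_def by (simp only: sum.distrib sum_subtractf sum_distrib_right)
    also have "\<dots> = G i j - G i n * G n j / of_real d"
      using GD by (cases "d = 0") (simp_all add: Gnn)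
    finally show ?thesis .
  qed
  \<comment> \<open>The Cholesky pattern: row \<open>n\<close> carries the rank-one part that was
    split off, and column \<open>n\<close> vanishes outside that row, so the two parts do not mix.
    The new row has \<open>n\<close> as its index because the factor for the first \<open>n\<close>
    columns uses only rows below \<open>n\<close>.\<close>
  define c' where "c' k i = (if k = n then G n i / of_real (sqrt d) else if i = n then 0 else c k i)" for k i
  have c'n: "cnj (c' n i) * c' n j = G i n * G n j / of_real d" for i j
  proof -
    have "of_real (sqrt d) * of_real (sqrt d) = (of_real d :: complex)"
      using d0 by (simp flip: of_real_mult)
    then show ?thesis by (simp add: c'_def herm)
  qed
  have "G i j = (\<Sum>k<Suc n. cnj (c' k i) * c' k j)" if "i < Suc n" "j < Suc n" for i j
  proof (cases "i = n \<or> j = n")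
    case True
    then have "(\<Sum>k<n. cnj (c' k i) * c' k j) = 0" by (auto simp: c'_def intro!: sum.neutral)
    moreover have "G i n * G n j / of_real d = G i j"
      using True GD by (cases "d = 0") (auto simp: Gnn)
    ultimately show ?thesis by (simp add: c'n)
  next
    case False
    then have "(\<Sum>k<n. cnj (c' k i) * c' k j) = (\<Sum>k<n. cnj (c k i) * c k j)"
      by (auto simp: c'_def)
    also have "\<dots> = G i j - G i n * G n j / of_real d" using c[of i j] False that f' by simp
    finally show ?thesis by (simp add: c'n)
  qed
  then show ?case unfolding G_def by blast
qed

text \<open>\<open>gram_square\<close> shrinks the Gram factor of each block to a square one, and
  the factors are then chosen for all labels at once. The index set may vary with the block, so a
  sum of Gram matrices can be presented by a single family \<open>f\<close> indexed by a product or
  a dependent sum.\<close>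

lemma epos_gramI:
  fixes f :: "'i label \<Rightarrow> 'k \<Rightarrow> nat \<Rightarrow> complex"
  assumes a: "a \<in> elems A" and S: "\<And>x. finite (S x)"
    and eq: "\<And>x i j. i < A x \<Longrightarrow> j < A x \<Longrightarrow> a x $$ (i, j) = (\<Sum>k\<in>S x. cnj (f x k i) * f x k j)"
  shows "epos A a"
proof -
  have "\<forall>x. \<exists>c. \<forall>i<A x. \<forall>j<A x. a x $$ (i, j) = (\<Sum>k<A x. cnj (c k i) * c k j)"
  proof
    fix x
    obtain c where "\<forall>i<A x. \<forall>j<A x. (\<Sum>k\<in>S x. cnj (f x k i) * f x k j) = (\<Sum>k<A x. cnj (c k i) * c k j)"
      using gram_square[OF S] by blast
    then show "\<exists>c. \<forall>i<A x. \<forall>j<A x. a x $$ (i, j) = (\<Sum>k<A x. cnj (c k i) * c k j)"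
      by (intro exI[of _ c]) (simp add: eq)
  qed
  from choice[OF this] obtain c where c: "\<And>x i j. i < A x \<Longrightarrow> j < A x \<Longrightarrow>
      a x $$ (i, j) = (\<Sum>k<A x. cnj (c x k i) * c x k j)" by blast
  let ?c = "\<lambda>x. mat (A x) (A x) (\<lambda>(k, i). c x k i)"
  have C: "?c \<in> elems A" by (auto intro!: elemsI)
  have "a = eadj ?c *\<^sub>e ?c"
  proof (rule elems_eqI[OF a])
    show "eadj ?c *\<^sub>e ?c \<in> elems A" using C by simp
    fix x i j assume "i < A x" "j < A x"
    then show "a x $$ (i, j) = (eadj ?c *\<^sub>e ?c) x $$ (i, j)"
      by (simp add: c emult_def eadj_def scalar_prod_def atLeast0LessThan)
  qed
  then show ?thesis using C unfolding epos_def by blast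
qed

lemma epos_gramE:
  assumes "epos A a"
  obtains c where "a \<in> elems A"
    "\<And>x i j. i < A x \<Longrightarrow> j < A x \<Longrightarrow> a x $$ (i, j) = (\<Sum>k<A x. cnj (c x k i) * c x k j)"
proof -
  obtain c where c: "c \<in> elems A" "a = eadj c *\<^sub>e c" using assms unfolding epos_def by blast
  show ?thesis
  proof
    show "a \<in> elems A" using c by simp
    fix x i j assume "i < A x" "j < A x"
    then show "a x $$ (i, j) = (\<Sum>k<A x. cnj (c x $$ (k, i)) * c x $$ (k, j))"
      using elemsD[OF c(1)] by (simp add: c(2) emult_def eadj_def scalar_prod_def atLeast0LessThan)
  qed
qed

lemma epos_hermitian:
  assumes "epos A a" "i < A x" "j < A x"
  shows "cnj (a x $$ (i, j)) = a x $$ (j, i)"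
proof -
  obtain c where "\<And>x i j. i < A x \<Longrightarrow> j < A x \<Longrightarrow> a x $$ (i, j) = (\<Sum>k<A x. cnj (c x k i) * c x k j)"
    using epos_gramE[OF assms(1)] by metis
  then show ?thesis using assms by (simp add: mult.commute)
qed

text \<open>The trace of a Gram matrix is the sum of the squared moduli of all entries of its
  factor. It is therefore real and nonnegative, and it vanishes only if the factor does.\<close>

lemma epos_trace:
  assumes A: "multi_matrix A" and a: "epos A a"
  shows "\<exists>t\<ge>0. etr A a = of_real t" and "etr A a = 0 \<Longrightarrow> a = ezero A"
proof -
  obtain c where ae: "a \<in> elems A" and
    c: "\<And>x i j. i < A x \<Longrightarrow> j < A x \<Longrightarrow> a x $$ (i, j) = (\<Sum>k<A x. cnj (c x k i) * c x k j)"
    using epos_gramE[OF a] by metis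
  define t where "t = (\<Sum>x | A x \<noteq> 0. \<Sum>i<A x. \<Sum>k<A x. (cmod (c x k i))\<^sup>2)"
  have tr: "etr A a = of_real t"
    unfolding etr_def t_def by (simp add: c complex_norm_square mult.commute del: of_real_power)
  moreover have "t \<ge> 0" unfolding t_def by (intro sum_nonneg) simp
  ultimately show "\<exists>t\<ge>0. etr A a = of_real t" by blast
  assume "etr A a = 0"
  then have t: "t = 0" using tr by simp
  have fin: "finite {x. A x \<noteq> 0}" using A unfolding multi_matrix_def .
  have z: "c x k i = 0" if "k < A x" "i < A x" for x k i
  proof -
    have "(\<Sum>i<A x. \<Sum>k<A x. (cmod (c x k i))\<^sup>2) = 0"
      using t that fin unfolding t_def by (subst (asm) sum_nonneg_eq_0_iff) (auto intro!: sum_nonneg)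
    then have "(\<Sum>k<A x. (cmod (c x k i))\<^sup>2) = 0"
      using that by (subst (asm) sum_nonneg_eq_0_iff) (auto intro!: sum_nonneg)
    then show ?thesis
      using that by (subst (asm) sum_nonneg_eq_0_iff) auto
  qed
  show "a = ezero A"
    by (rule elems_eqI[OF ae elems_closed(6)]) (simp add: c z ezero_def)
qed

section \<open>Coordinates on tensor products\<close>

lemma tensor_algE:
  assumes "i < (A \<otimes>\<^sub>a B) z"
  obtains x y where "z = LPair x y" "i < A x * B y"
  using assms by (auto simp: tensor_alg_def split: label.splits)

lemma tensor_alg_LPair [simp]: "(A \<otimes>\<^sub>a B) (LPair x y) = A x * B y"
  by (simp add: tensor_alg_def)

text \<open>The maps fixed by definite description are known only on elementary tensors. These span
  the tensor product by the expansion in matrix units, and zero is itself an elementary tensor, so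
  entry formulas for such maps can be proved by this induction.\<close>

lemma tensor_induct [consumes 3, case_names tensor add smult]:
  assumes A: "multi_matrix A" and B: "multi_matrix B" and T: "T \<in> elems (A \<otimes>\<^sub>a B)"
    and tensor: "\<And>a b. a \<in> elems A \<Longrightarrow> b \<in> elems B \<Longrightarrow> P (a \<otimes>\<^sub>e b)"
    and add: "\<And>S T. S \<in> elems (A \<otimes>\<^sub>a B) \<Longrightarrow> T \<in> elems (A \<otimes>\<^sub>a B) \<Longrightarrow> P S \<Longrightarrow> P T \<Longrightarrow> P (S +\<^sub>e T)"
    and smult: "\<And>c T. T \<in> elems (A \<otimes>\<^sub>a B) \<Longrightarrow> P T \<Longrightarrow> P (c \<cdot>\<^sub>e T)"
  shows "P T"
proof -
  have zero: "P (ezero (A \<otimes>\<^sub>a B))"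
  proof -
    have "ezero (A \<otimes>\<^sub>a B) = ezero A \<otimes>\<^sub>e ezero B"
    proof (rule elems_eqI[where A = "A \<otimes>\<^sub>a B"])
      fix z i j assume ij: "i < (A \<otimes>\<^sub>a B) z" "j < (A \<otimes>\<^sub>a B) z"
      from ij(1) obtain x y where z: "z = LPair x y" by (rule tensor_algE)
      show "ezero (A \<otimes>\<^sub>a B) z $$ (i, j) = (ezero A \<otimes>\<^sub>e ezero B) z $$ (i, j)"
        using ij by (simp add: z tensor_index[of _ A _ B] div_mod_less) (simp add: ezero_def div_mod_less)
    qed auto
    then show ?thesis by (simp add: tensor)
  qed
  have *: "P (esum (A \<otimes>\<^sub>a B) f S)"
    if "finite S" "\<And>s. s \<in> S \<Longrightarrow> f s \<in> elems (A \<otimes>\<^sub>a B) \<and> P (f s)" for f and S :: "'s set"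
    using that by induction (auto simp: zero esum_empty esum_insert intro!: add)
  show ?thesis
    by (subst tensor_expand[OF A B T], rule *) (use A B in \<open>auto intro!: smult tensor\<close>)
qed

text \<open>The coefficient, lying in \<open>B\<close>, of the matrix unit at
  \<open>(x, i, j)\<close> when \<open>T\<close> is expanded along the first tensor factor.\<close>

definition slice :: "'i alg \<Rightarrow> 'i elem \<Rightarrow> 'i label \<Rightarrow> nat \<Rightarrow> nat \<Rightarrow> 'i elem" where
  "slice B T x i j = (\<lambda>y. mat (B y) (B y) (\<lambda>(k, l). T (LPair x y) $$ (i * B y + k, j * B y + l)))"

lemma slice_elems [simp]: "slice B T x i j \<in> elems B"
  by (auto intro!: elemsI simp: slice_def)

lemma slice_index:
  "k < B y \<Longrightarrow> l < B y \<Longrightarrow> slice B T x i j y $$ (k, l) = T (LPair x y) $$ (i * B y + k, j * B y + l)"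
  by (simp add: slice_def)

lemma slice_tensor:
  assumes "a \<in> elems A" "b \<in> elems B" "i < A x" "j < A x"
  shows "slice B (a \<otimes>\<^sub>e b) x i j = a x $$ (i, j) \<cdot>\<^sub>e b"
  by (rule elems_eqI[where A = B])
    (use assms in \<open>auto simp: slice_index tensor_index[of _ A _ B] mlex_bound eindex[of _ B]\<close>)

lemma slice_lin:
  assumes "S \<in> elems (A \<otimes>\<^sub>a B)" "T \<in> elems (A \<otimes>\<^sub>a B)" "i < A x" "j < A x"
  shows "slice B (S +\<^sub>e T) x i j = slice B S x i j +\<^sub>e slice B T x i j"
    "slice B (c \<cdot>\<^sub>e T) x i j = c \<cdot>\<^sub>e slice B T x i j"
  by (rule elems_eqI[where A = B],
    use assms in \<open>auto simp: slice_index eindex[of _ B] eindex[of _ "A \<otimes>\<^sub>a B"] mlex_bound\<close>)+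

text \<open>The map acts on the coefficients along the first factor. This is immediate for
  elementary tensors, and both sides are linear in \<open>T\<close>.\<close>

lemma id_tensor_index:
  assumes A: "multi_matrix A" and C: "multi_matrix C" and L: "\<Phi> \<in> lin_maps A B"
    and T: "T \<in> elems (C \<otimes>\<^sub>a A)" and ij: "i < C x * B y" "j < C x * B y"
  shows "id_tensor C A B \<Phi> T (LPair x y) $$ (i, j) =
    \<Phi> (slice A T x (i div B y) (j div B y)) y $$ (i mod B y, j mod B y)"
proof -
  note I = id_tensor[OF A C L]
  note dm = div_mod_less[OF ij(1)] div_mod_less[OF ij(2)]
  from C A T show ?thesis
  proof (induction rule: tensor_induct)
    case (tensor c a)
    then show ?case
      using dm ij lin_mapsD(1)[OF L, of a]
      by (simp add: I slice_tensor[of _ C _ A] lin_mapsD(3)[OF L] tensor_index[of _ C _ B] eindex[of _ B])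
  next
    case (add S T)
    then show ?case using dm ij lin_mapsD(1)[OF L] lin_mapsD(1)[OF I(1)]
      by (simp add: slice_lin[of _ C] lin_mapsD(2)[OF L] lin_mapsD(2)[OF I(1)] eindex[of _ B]
          eindex[of _ "C \<otimes>\<^sub>a B"])
  next
    case (smult c T)
    then show ?case using dm ij lin_mapsD(1)[OF L] lin_mapsD(1)[OF I(1)]
      by (simp add: slice_lin[of _ C] lin_mapsD(3)[OF L] lin_mapsD(3)[OF I(1)] eindex[of _ B]
          eindex[of _ "C \<otimes>\<^sub>a B"])
  qed
qed

lemma ptr_fst_index:
  assumes A: "multi_matrix A" and B: "multi_matrix B"
    and T: "T \<in> elems (A \<otimes>\<^sub>a B)" and kl: "k < B y" "l < B y"
  shows "ptr_fst A B T y $$ (k, l) =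
    (\<Sum>x | A x \<noteq> 0. \<Sum>i<A x. T (LPair x y) $$ (i * B y + k, i * B y + l))"
proof -
  note I = partial_traces(1)[OF A B] partial_traces(3)[OF A B]
  from A B T show ?thesis
  proof (induction rule: tensor_induct)
    case (tensor a b)
    then show ?case using kl
      by (simp add: I eindex[of _ B] tensor_index[of _ A _ B] mlex_bound etr_def sum_distrib_right)
  next
    case (add S T)
    then show ?case using kl lin_mapsD(1)[OF I(1)]
      by (simp add: lin_mapsD(2)[OF I(1)] eindex[of _ B] eindex[of _ "A \<otimes>\<^sub>a B"] mlex_bound sum.distrib)
  next
    case (smult c T)
    then show ?case using kl lin_mapsD(1)[OF I(1)]
      by (simp add: lin_mapsD(3)[OF I(1)] eindex[of _ B] eindex[of _ "A \<otimes>\<^sub>a B"] mlex_bound sum_distrib_left)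
  qed
qed

lemma eadj_index:
  "a \<in> elems A \<Longrightarrow> i < A x \<Longrightarrow> j < A x \<Longrightarrow> eadj a x $$ (i, j) = cnj (a x $$ (j, i))"
  by (simp add: eadj_def elemsD)

text \<open>In a composite index, \<open>div\<close> selects the first factor and \<open>mod\<close>
  the second. Swapping the factors exchanges these two digits, while the adjoint exchanges row with
  column and conjugates.\<close>

lemma time_reversal_index:
  assumes A: "multi_matrix A" and B: "multi_matrix B"
    and T: "T \<in> elems (B \<otimes>\<^sub>a A)" and ij: "i < A x * B y" "j < A x * B y"
  shows "time_reversal B A T (LPair x y) $$ (i, j) =
    cnj (T (LPair y x) $$ ((j mod B y) * A x + j div B y, (i mod B y) * A x + i div B y))"
proof -
  note I = time_reversal[OF A B]
  note dm = div_mod_less[OF ij(1)] div_mod_less[OF ij(2)]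
  have R: "time_reversal B A T \<in> elems (A \<otimes>\<^sub>a B)" if "T \<in> elems (B \<otimes>\<^sub>a A)" for T
    using I(1) that by (auto simp: conj_lin_maps_def)
  from B A T show ?thesis
  proof (induction rule: tensor_induct)
    case (tensor b a)
    then show ?case using dm ij
      by (simp add: I tensor_index[of _ A _ B] tensor_index[of _ B _ A] mlex_bound
          eadj_index[of _ A] eadj_index[of _ B])
  next
    case (add S T)
    then show ?case using dm ij I(1) R
      by (simp add: conj_lin_maps_def eindex[of _ "A \<otimes>\<^sub>a B"] eindex[of _ "B \<otimes>\<^sub>a A"] mlex_bound)
  next
    case (smult c T)
    then show ?case using dm ij I(1) R
      by (simp add: conj_lin_maps_def eindex[of _ "A \<otimes>\<^sub>a B"] eindex[of _ "B \<otimes>\<^sub>a A"] mlex_bound)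
  qed
qed

section \<open>The trace and the partial trace\<close>

lemma sum_div_mod:
  fixes f g :: "nat \<Rightarrow> complex"
  shows "(\<Sum>i<m * n. f (i div n) * g (i mod n)) = (\<Sum>i<m. f i) * (\<Sum>i<n. g i)"
proof -
  have "(\<Sum>i<m * n. f (i div n) * g (i mod n)) = (\<Sum>(i, j)\<in>{..<m} \<times> {..<n}. f i * g j)"
    by (rule sum.reindex_bij_witness[of _ "\<lambda>(i, j). i * n + j" "\<lambda>i. (i div n, i mod n)"])
      (auto simp: div_mod_less mlex_bound)
  then show ?thesis by (simp add: sum_product sum.cartesian_product)
qed

lemma etr_tensor:
  assumes "a \<in> elems A" "b \<in> elems B"
  shows "etr (A \<otimes>\<^sub>a B) (a \<otimes>\<^sub>e b) = etr A a * etr B b"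
proof -
  have S: "{z. (A \<otimes>\<^sub>a B) z \<noteq> 0} = (\<lambda>(x, y). LPair x y) ` ({x. A x \<noteq> 0} \<times> {y. B y \<noteq> 0})"
  proof (rule Set.set_eqI)
    fix z show "z \<in> {z. (A \<otimes>\<^sub>a B) z \<noteq> 0} \<longleftrightarrow> z \<in> (\<lambda>(x, y). LPair x y) ` ({x. A x \<noteq> 0} \<times> {y. B y \<noteq> 0})"
      by (cases z) (auto simp: tensor_alg_def)
  qed
  have "etr (A \<otimes>\<^sub>a B) (a \<otimes>\<^sub>e b) = (\<Sum>(x, y)\<in>{x. A x \<noteq> 0} \<times> {y. B y \<noteq> 0}.
      \<Sum>i<A x * B y. (a \<otimes>\<^sub>e b) (LPair x y) $$ (i, i))"
    unfolding etr_def S by (subst sum.reindex) (auto intro!: inj_onI simp: split_def)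
  also have "\<dots> = (\<Sum>(x, y)\<in>{x. A x \<noteq> 0} \<times> {y. B y \<noteq> 0}.
      (\<Sum>i<A x. a x $$ (i, i)) * (\<Sum>i<B y. b y $$ (i, i)))"
    by (intro sum.cong refl) (auto simp: tensor_index[OF assms] simp flip: sum_div_mod)
  also have "\<dots> = etr A a * etr B b"
    by (simp add: etr_def sum_product sum.cartesian_product[symmetric])
  finally show ?thesis .
qed

lemma etr_ptr_fst:
  assumes A: "multi_matrix A" and B: "multi_matrix B" and T: "T \<in> elems (A \<otimes>\<^sub>a B)"
  shows "etr B (ptr_fst A B T) = etr (A \<otimes>\<^sub>a B) T"
proof -
  note I = partial_traces(1)[OF A B] partial_traces(3)[OF A B]
  from A B T show ?thesis
    by (induction rule: tensor_induct)
      (simp_all add: I etr_tensor etr_lin(1)[of _ B] etr_lin(1)[of _ "A \<otimes>\<^sub>a B"]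
        etr_smult[of _ B] etr_smult[of _ "A \<otimes>\<^sub>a B"] lin_mapsD[OF I(1)])
qed

lemma multi_matrix_full [simp]: "multi_matrix (full_matrix_alg l n)"
proof -
  have "{x. full_matrix_alg l n x \<noteq> 0} \<subseteq> {l}" by (auto simp: full_matrix_alg_def)
  then show ?thesis unfolding multi_matrix_def using finite_subset by blast
qed

text \<open>The partial trace adds up diagonal sub-blocks. Each is a Gram matrix, and collecting
  their vectors under one index \<open>(x, p, m)\<close> makes the sum a Gram matrix again.\<close>

lemma epos_ptr_fst:
  assumes A: "multi_matrix A" and B: "multi_matrix B" and T: "epos (A \<otimes>\<^sub>a B) T"
  shows "epos B (ptr_fst A B T)"
proof -
  obtain c where Te: "T \<in> elems (A \<otimes>\<^sub>a B)"
    and c: "\<And>z i j. i < (A \<otimes>\<^sub>a B) z \<Longrightarrow> j < (A \<otimes>\<^sub>a B) z \<Longrightarrow>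
      T z $$ (i, j) = (\<Sum>k<(A \<otimes>\<^sub>a B) z. cnj (c z k i) * c z k j)"
    using epos_gramE[OF T] by metis
  let ?S = "\<lambda>y. SIGMA x:{x. A x \<noteq> 0}. {..<A x} \<times> {..<A x * B y}"
  let ?f = "\<lambda>y (x, p, m) i. c (LPair x y) m (p * B y + i)"
  show ?thesis
  proof (rule epos_gramI[where S = ?S and f = ?f])
    show "ptr_fst A B T \<in> elems B" using lin_mapsD(1)[OF partial_traces(1)[OF A B] Te] .
    show "finite (?S y)" for y using A by (auto simp: multi_matrix_def)
    fix y i j assume "i < B y" "j < B y"
    then show "ptr_fst A B T y $$ (i, j) = (\<Sum>k\<in>?S y. cnj (?f y k i) * ?f y k j)"
      using A by (simp add: ptr_fst_index[OF A B Te] c mlex_bound sum.Sigma multi_matrix_def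
          sum.cartesian_product split_def)
  qed
qed

lemma ptr_fst_CPTP:
  assumes A: "multi_matrix A" and B: "multi_matrix B"
  shows "ptr_fst A B \<in> CPTP (A \<otimes>\<^sub>a B) B"
proof -
  note L = partial_traces(1)[OF A B]
  note AB = multi_matrix_tensor[OF A B]
  \<comment> \<open>The same Gram argument with an ancilla \<open>F\<close>, taken to be any
    multi-matrix algebra; full matrix algebras are then a special case.\<close>
  have "epos (F \<otimes>\<^sub>a B) (id_tensor F (A \<otimes>\<^sub>a B) B (ptr_fst A B) T)"
    if F: "multi_matrix F" and T: "epos (F \<otimes>\<^sub>a (A \<otimes>\<^sub>a B)) T" for F :: "'a alg" and T
  proof -
    obtain c where Te: "T \<in> elems (F \<otimes>\<^sub>a (A \<otimes>\<^sub>a B))"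
      and c: "\<And>z i j. i < (F \<otimes>\<^sub>a (A \<otimes>\<^sub>a B)) z \<Longrightarrow> j < (F \<otimes>\<^sub>a (A \<otimes>\<^sub>a B)) z \<Longrightarrow>
        T z $$ (i, j) = (\<Sum>k<(F \<otimes>\<^sub>a (A \<otimes>\<^sub>a B)) z. cnj (c z k i) * c z k j)"
      using epos_gramE[OF T] by metis
    let ?S = "\<lambda>z. case z of Lbl _ \<Rightarrow> {} | LPair l y \<Rightarrow>
      (SIGMA x:{x. A x \<noteq> 0}. {..<A x} \<times> {..<F l * (A x * B y)})"
    \<comment> \<open>The three digits of the long index are \<open>i div B y\<close> in
      \<open>F\<close>, the traced position \<open>p\<close> in \<open>A\<close>, and
      \<open>i mod B y\<close> in \<open>B\<close>. Tracing puts the same \<open>p\<close> into row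
      and column, so \<open>p\<close> can label the Gram vectors.\<close>
    let ?f = "\<lambda>z (x, p, m) i. case z of Lbl _ \<Rightarrow> 0 | LPair l y \<Rightarrow>
      c (LPair l (LPair x y)) m ((i div B y) * (A x * B y) + (p * B y + i mod B y))"
    show ?thesis
    proof (rule epos_gramI[where S = ?S and f = ?f])
      show "id_tensor F (A \<otimes>\<^sub>a B) B (ptr_fst A B) T \<in> elems (F \<otimes>\<^sub>a B)"
        using lin_mapsD(1)[OF id_tensor(1)[OF AB F L] Te] .
      show "finite (?S z)" for z using A by (auto simp: multi_matrix_def split: label.splits)
      fix z i j assume ij: "i < (F \<otimes>\<^sub>a B) z" "j < (F \<otimes>\<^sub>a B) z"
      from ij(1) obtain l y where z: "z = LPair l y" by (rule tensor_algE)
      have ij': "i < F l * B y" "j < F l * B y" using ij by (simp_all add: z)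
      show "id_tensor F (A \<otimes>\<^sub>a B) B (ptr_fst A B) T z $$ (i, j) = (\<Sum>k\<in>?S z. cnj (?f z k i) * ?f z k j)"
        using A div_mod_less[OF ij'(1)] div_mod_less[OF ij'(2)]
        by (simp add: z id_tensor_index[OF AB F L Te ij'] ptr_fst_index[OF A B] slice_index c mlex_bound
            sum.Sigma multi_matrix_def sum.cartesian_product split_def)
    qed
  qed
  then show ?thesis
    using L etr_ptr_fst[OF A B] by (simp add: CPTP_def completely_positive_def positive_map_def)
qed

section \<open>Channel states\<close>

lemma munit_tensor:
  assumes "i < A x * B y" "j < A x * B y"
  shows "munit (A \<otimes>\<^sub>a B) (LPair x y, i, j) =
    munit A (x, i div B y, j div B y) \<otimes>\<^sub>e munit B (y, i mod B y, j mod B y)"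
proof (rule elems_eqI[where A = "A \<otimes>\<^sub>a B"])
  fix z k l assume kl: "k < (A \<otimes>\<^sub>a B) z" "l < (A \<otimes>\<^sub>a B) z"
  from kl(1) obtain u v where z: "z = LPair u v" by (rule tensor_algE)
  have kl': "k < A u * B v" "l < A u * B v" using kl by (simp_all add: z)
  have "(k div B v = i div B v \<and> k mod B v = i mod B v) = (k = i)"
    "(l div B v = j div B v \<and> l mod B v = j mod B v) = (l = j)"
    by (metis div_mult_mod_eq)+
  then show "munit (A \<otimes>\<^sub>a B) (LPair x y, i, j) z $$ (k, l) =
    (munit A (x, i div B y, j div B y) \<otimes>\<^sub>e munit B (y, i mod B y, j mod B y)) z $$ (k, l)"
    using munit_tensor_index[where A = A and B = B, OF kl', of "((x, i div B y, j div B y), (y, i mod B y, j mod B y))"] kl'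
    by (auto simp: z munit_index)
qed auto

lemma etr_munit_mult:
  assumes A: "multi_matrix A" and b: "b \<in> elems A" and ij: "i < A x" "j < A x"
  shows "etr A (munit A (x, i, j) *\<^sub>e b) = b x $$ (j, i)"
proof -
  have "eadj (munit A (x, j, i)) = munit A (x, i, j)"
    by (rule elems_eqI[where A = A]) (auto simp: eadj_index[of _ A] munit_index)
  then show ?thesis
    using hs_munit[OF A b, of "(x, j, i)"] ij by (simp add: bas_iff ecoef_def)
qed

lemma etr_eadj_one:
  assumes p: "p \<in> elems A"
  shows "etr A (eadj p *\<^sub>e eone A) = cnj (etr A p)"
proof -
  have "eadj p x * 1\<^sub>m (A x) = eadj p x" for x
    using elemsD[OF elems_closed(4)[OF p], of x] by (intro right_mult_one_mat) auto
  then have "eadj p *\<^sub>e eone A = eadj p" by (simp add: emult_def eone_def)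
  then show ?thesis by (simp add: etr_def eadj_index[OF p])
qed

lemma eone_elems [simp]: "eone A \<in> elems A"
  by (auto intro!: elemsI simp: eone_def)

lemma channel_state_elems:
  assumes A: "multi_matrix A" and L: "\<Phi> \<in> lin_maps A B"
  shows "channel_state A B \<Phi> \<in> elems (A \<otimes>\<^sub>a B)"
  unfolding channel_state_def
  by (intro lin_mapsD(1)[OF id_tensor(1)[OF A A L]] eone_elems
      lin_mapsD(1)[OF hs_adjoint(1)[OF multi_matrix_tensor[OF A A] A mult_map(1)[OF A]]])

text \<open>Equivalently, the channel state is the sum of the \<open>e\<^sub>i\<^sub>j \<otimes> \<Phi>(e\<^sub>j\<^sub>i)\<close> over all matrix units.\<close>

lemma channel_state_index:
  assumes A: "multi_matrix A" and L: "\<Phi> \<in> lin_maps A B"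
    and ij: "i < A x * B y" "j < A x * B y"
  shows "channel_state A B \<Phi> (LPair x y) $$ (i, j) =
    \<Phi> (munit A (x, j div B y, i div B y)) y $$ (i mod B y, j mod B y)"
proof -
  note AA = multi_matrix_tensor[OF A A]
  note H = hs_adjoint[OF AA A mult_map(1)[OF A]]
  define M where "M = hs_adjoint (A \<otimes>\<^sub>a A) A (mult_map A) (eone A)"
  have M: "M \<in> elems (A \<otimes>\<^sub>a A)" unfolding M_def using lin_mapsD(1)[OF H(1)] by simp
  \<comment> \<open>Pairing with a matrix unit reads off an entry. Moving the adjoint across turns
    the entry into the conjugate trace of a product of two matrix units, which is 1 exactly if they
    are transposes of each other. So \<open>M\<close> is the sum of all tensors of a matrix unit
    with its transpose.\<close>
  have Mi: "M (LPair u v) $$ (k, l) = (if (u, l div A v, k div A v) = (v, k mod A v, l mod A v) then 1 else 0)"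
    if kl: "k < A u * A v" "l < A u * A v" for u v k l
  proof -
    note dm = div_mod_less[OF kl(1)] div_mod_less[OF kl(2)]
    let ?e = "(LPair u v, k, l)"
    let ?p = "munit A (u, k div A v, l div A v) *\<^sub>e munit A (v, k mod A v, l mod A v)"
    have "M (LPair u v) $$ (k, l) = etr (A \<otimes>\<^sub>a A) (eadj (munit (A \<otimes>\<^sub>a A) ?e) *\<^sub>e M)"
      using hs_munit[OF AA M, of ?e] kl by (simp add: bas_iff ecoef_def)
    also have "\<dots> = etr A (eadj (mult_map A (munit (A \<otimes>\<^sub>a A) ?e)) *\<^sub>e eone A)"
      unfolding M_def by (rule H(2)[symmetric]) auto
    also have "mult_map A (munit (A \<otimes>\<^sub>a A) ?e) = ?p"
      unfolding munit_tensor[where A = A and B = A, OF kl] by (rule mult_map(2)[OF A]) auto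
    also have "etr A (eadj ?p *\<^sub>e eone A) = cnj (etr A ?p)"
      by (rule etr_eadj_one) simp
    also have "\<dots> = (if (u, l div A v, k div A v) = (v, k mod A v, l mod A v) then 1 else 0)"
      using dm by (simp add: etr_munit_mult[OF A] munit_index)
    finally show ?thesis .
  qed
  note dm = div_mod_less[OF ij(1)] div_mod_less[OF ij(2)]
  have "slice A M x (i div B y) (j div B y) = munit A (x, j div B y, i div B y)"
    by (rule elems_eqI[where A = A]) (use dm in \<open>auto simp: slice_index Mi mlex_bound munit_index\<close>)
  then show ?thesis
    unfolding channel_state_def M_def[symmetric] by (simp add: id_tensor_index[OF A A L M ij])
qed

section \<open>Elements with scalar blocks, which are central\<close>

lemma scalar_block:
  fixes M :: "complex mat"
  assumes "M \<in> carrier_mat n n"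
  shows "(c \<cdot>\<^sub>m 1\<^sub>m n) * M = c \<cdot>\<^sub>m M" "M * (c \<cdot>\<^sub>m 1\<^sub>m n) = c \<cdot>\<^sub>m M"
  using assms mult_smult_assoc_mat[OF one_carrier_mat assms, of c]
    mult_smult_distrib[OF assms one_carrier_mat, of c] by auto

text \<open>This discharges the commutation condition for both states over time: the scalar element
  is the channel state for the partial trace, and \<sigma> tensored with the unit for a channel out
  of the classical algebra.\<close>

lemma scalar_blocks:
  assumes a: "a \<in> elems A" and b: "b \<in> elems A" and c: "\<And>z. b z = c z \<cdot>\<^sub>m 1\<^sub>m (A z)"
  shows "a *\<^sub>e b = (\<lambda>z. c z \<cdot>\<^sub>m a z)" "b *\<^sub>e a = (\<lambda>z. c z \<cdot>\<^sub>m a z)"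
    "ecomm a b = ezero A" "ecomm b a = ezero A"
proof -
  have m: "a z \<in> carrier_mat (A z) (A z)" for z using a by (simp add: elems_def)
  show "a *\<^sub>e b = (\<lambda>z. c z \<cdot>\<^sub>m a z)" "b *\<^sub>e a = (\<lambda>z. c z \<cdot>\<^sub>m a z)"
    by (simp_all add: emult_def c scalar_block[OF m])
  have s: "c z \<cdot>\<^sub>m a z - c z \<cdot>\<^sub>m a z = 0\<^sub>m (A z) (A z)" for z
    using m by (intro minus_r_inv_mat) auto
  then show "ecomm a b = ezero A" "ecomm b a = ezero A"
    by (simp_all add: ecomm_def ezero_def c scalar_block[OF m])
qed

section \<open>Channels to and from a classical algebra\<close>

lemma classical_alg_less [simp]: "i < classical_alg X x \<longleftrightarrow> x \<in> X \<and> i = 0"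
  by (simp add: classical_alg_def)

lemma classical_alg_in: "x \<in> X \<Longrightarrow> classical_alg X x = 1"
  by (simp add: classical_alg_def)

lemma multi_matrix_classical: "finite X \<Longrightarrow> multi_matrix (classical_alg X)"
  by (simp add: multi_matrix_def classical_alg_def)

lemma munit_classical: "x \<in> X \<Longrightarrow> munit (classical_alg X) (x, 0, 0) = delta X x"
  by (rule elems_eqI[where A = "classical_alg X"])
    (auto intro!: elemsI simp: delta_def munit_index classical_alg_in)

lemma delta_elems [simp]: "delta X x \<in> elems (classical_alg X)"
  by (auto intro!: elemsI simp: delta_def)

lemma delta_index: "y \<in> X \<Longrightarrow> delta X x y $$ (0, 0) = (if y = x then 1 else 0)"
  by (auto simp: delta_def classical_alg_in)

text \<open>The elements \<open>delta X x\<close> are all the matrix units of the classical algebra,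
  hence a basis. This yields uniqueness of the Bayesian inverse.\<close>

lemma lin_classical_eqI:
  assumes X: "finite X" and L: "\<Phi> \<in> lin_maps (classical_alg X) A" "\<Psi> \<in> lin_maps (classical_alg X) A"
    and eq: "\<And>x. x \<in> X \<Longrightarrow> \<Phi> (delta X x) = \<Psi> (delta X x)"
  shows "\<Phi> = \<Psi>"
proof (rule extensionalityI)
  let ?C = "classical_alg X"
  note C = multi_matrix_classical[OF X]
  fix c assume c: "c \<in> elems ?C"
  have *: "\<Xi> c = esum A (\<lambda>e. ecoef c e \<cdot>\<^sub>e \<Xi> (munit ?C e)) (bas ?C)" if "\<Xi> \<in> lin_maps ?C A" for \<Xi>
    using lin_esum[OF that finite_bas[OF C], of "\<lambda>e. ecoef c e \<cdot>\<^sub>e munit ?C e"]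
    by (simp add: lin_mapsD(3)[OF that] flip: expand[OF C c])
  show "\<Phi> c = \<Psi> c"
    unfolding *[OF L(1)] *[OF L(2)]
    by (rule esum_cong) (auto simp: bas_iff munit_classical eq)
qed (use L in \<open>auto dest: lin_mapsD(4)\<close>)

text \<open>By \<open>channel_state_index\<close> each entry is a component of the partial trace of
  a matrix unit. Tracing out \<open>B\<close> keeps only diagonal units, and the classical label
  must match.\<close>

lemma channel_state_ptr_fst_classical:
  assumes B: "multi_matrix B" and X: "finite X"
  defines "C \<equiv> classical_alg X"
  shows "channel_state (B \<otimes>\<^sub>a C) C (ptr_fst B C) (LPair (LPair b x) y) =
    (if x = y then 1 else 0) \<cdot>\<^sub>m 1\<^sub>m (B b * C x * C y)"
proof -
  have C: "multi_matrix C" unfolding C_def using X by (rule multi_matrix_classical)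
  note BC = multi_matrix_tensor[OF B C]
  note L = partial_traces(1)[OF B C]
  let ?D = "channel_state (B \<otimes>\<^sub>a C) C (ptr_fst B C)"
  have D: "?D \<in> elems ((B \<otimes>\<^sub>a C) \<otimes>\<^sub>a C)" by (rule channel_state_elems[OF BC L])
  show ?thesis
  proof (rule eq_matI)
    fix i j
    assume "i < dim_row ((if x = y then 1 else 0) \<cdot>\<^sub>m 1\<^sub>m (B b * C x * C y) :: complex mat)"
      "j < dim_col ((if x = y then 1 else 0) \<cdot>\<^sub>m 1\<^sub>m (B b * C x * C y) :: complex mat)"
    then have ij: "i < B b * C x * C y" "j < B b * C x * C y" by simp_all
    \<comment> \<open>A nonempty block forces both classical dimensions to be 1, so the composite
      index coincides with the index in \<open>B\<close>.\<close>
    then have "0 < C x" "0 < C y" by (auto intro!: Nat.gr0I)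
    then have xy: "x \<in> X" "y \<in> X" "C x = 1" "C y = 1"
      by (auto simp: C_def classical_alg_in)
    then have ij': "i < B b" "j < B b" using ij by simp_all
    have "?D (LPair (LPair b x) y) $$ (i, j) =
        (\<Sum>b' | B b' \<noteq> 0. \<Sum>k<B b'. munit (B \<otimes>\<^sub>a C) (LPair b x, j, i) (LPair b' y) $$ (k, k))"
      using ij xy by (simp add: channel_state_index[OF BC L] ptr_fst_index[OF B C])
    also have "\<dots> = (\<Sum>b' | B b' \<noteq> 0. if b' = b then
        (\<Sum>k<B b. if k = j then (if x = y \<and> i = j then 1 else 0) else 0) else 0)"
      using xy by (intro sum.cong refl) (auto simp: munit_index intro!: sum.cong sum.neutral)
    also have "\<dots> = (if x = y \<and> i = j then 1 else 0)"
      using ij' B by (auto simp: multi_matrix_def)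
    finally show "?D (LPair (LPair b x) y) $$ (i, j) =
        ((if x = y then 1 else 0) \<cdot>\<^sub>m 1\<^sub>m (B b * C x * C y)) $$ (i, j)"
      using ij by auto
  qed (use elemsD[OF D, of "LPair (LPair b x) y"] in simp_all)
qed

lemma sot_ptr_fst_classical:
  assumes cl: "classical_limit_axiom star" and B: "multi_matrix B" and X: "finite X"
    and \<rho>: "\<rho> \<in> states (B \<otimes>\<^sub>a classical_alg X)" and xy: "x \<in> X" "y \<in> X" and ij: "i < B b" "j < B b"
  defines "C \<equiv> classical_alg X"
  shows "star (B \<otimes>\<^sub>a C) C (ptr_fst B C) \<rho> (LPair (LPair b x) y) $$ (i, j) =
    (if x = y then \<rho> (LPair b x) $$ (i, j) else 0)"
proof -
  have C: "multi_matrix C" unfolding C_def using X by (rule multi_matrix_classical)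
  note BC = multi_matrix_tensor[OF B C]
  let ?D = "channel_state (B \<otimes>\<^sub>a C) C (ptr_fst B C)"
  have \<rho>e: "\<rho> \<in> elems (B \<otimes>\<^sub>a C)" using \<rho> epos_gramE unfolding states_def C_def by blast
  have D: "?D \<in> elems ((B \<otimes>\<^sub>a C) \<otimes>\<^sub>a C)" by (rule channel_state_elems[OF BC partial_traces(1)[OF B C]])
  have R: "\<rho> \<otimes>\<^sub>e eone C \<in> elems ((B \<otimes>\<^sub>a C) \<otimes>\<^sub>a C)" using \<rho>e by simp
  \<comment> \<open>The default 0 concerns labels that are not nested pairs of the required shape;
    the blocks there are empty.\<close>
  define d :: "'a label \<Rightarrow> complex"
    where "d z = (case z of LPair (LPair b x) y \<Rightarrow> if x = y then 1 else 0 | _ \<Rightarrow> 0)" for z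
  have blk: "?D z = d z \<cdot>\<^sub>m 1\<^sub>m (((B \<otimes>\<^sub>a C) \<otimes>\<^sub>a C) z)" for z
  proof (cases "\<exists>b x y. z = LPair (LPair b x) y")
    case True
    then show ?thesis
      using channel_state_ptr_fst_classical[OF B X] by (auto simp: d_def C_def)
  next
    case False
    then have "((B \<otimes>\<^sub>a C) \<otimes>\<^sub>a C) z = 0" by (auto simp: tensor_alg_def split: label.splits)
    then show ?thesis using elemsD[OF D, of z] by (intro eq_matI) auto
  qed
  note sb = scalar_blocks[OF R D blk]
  have "star (B \<otimes>\<^sub>a C) C (ptr_fst B C) \<rho> = ?D *\<^sub>e (\<rho> \<otimes>\<^sub>e eone C)"
    using cl BC C ptr_fst_CPTP[OF B C] \<rho> sb(4) unfolding classical_limit_axiom_def C_def by blast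
  moreover have "C x = 1" "C y = 1" using xy by (simp_all add: C_def classical_alg_in)
  moreover have "(\<rho> \<otimes>\<^sub>e eone C) (LPair (LPair b x) y) $$ (i, j) = \<rho> (LPair b x) $$ (i, j)"
    using ij \<open>C x = 1\<close> \<open>C y = 1\<close> by (simp add: tensor_index[OF \<rho>e eone_elems]) (simp add: eone_def)
  ultimately show ?thesis
    using ij elemsD[OF R, of "LPair (LPair b x) y"] by (simp add: sb(2) d_def)
qed

lemma sot_from_classical:
  assumes cl: "classical_limit_axiom star" and A: "multi_matrix A" and X: "finite X"
    and \<Psi>: "\<Psi> \<in> CPTP (classical_alg X) A" and \<sigma>: "\<sigma> \<in> states (classical_alg X)"
    and x: "x \<in> X" and ij: "i < A z" "j < A z"
  defines "C \<equiv> classical_alg X"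
  shows "star C A \<Psi> \<sigma> (LPair x z) $$ (i, j) = \<sigma> x $$ (0, 0) * \<Psi> (delta X x) z $$ (i, j)"
proof -
  have C: "multi_matrix C" unfolding C_def using X by (rule multi_matrix_classical)
  have L: "\<Psi> \<in> lin_maps C A" using \<Psi> unfolding CPTP_def C_def by blast
  let ?D = "channel_state C A \<Psi>"
  have \<sigma>e: "\<sigma> \<in> elems C" using \<sigma> epos_gramE unfolding states_def C_def by blast
  have D: "?D \<in> elems (C \<otimes>\<^sub>a A)" by (rule channel_state_elems[OF C L])
  have R: "\<sigma> \<otimes>\<^sub>e eone A \<in> elems (C \<otimes>\<^sub>a A)" using \<sigma>e by simp
  \<comment> \<open>A classical block has size 1, so its single entry is the scalar by which
    \<sigma> tensored with the unit acts on the block.\<close>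
  define s where "s z = (case z of LPair x _ \<Rightarrow> \<sigma> x $$ (0, 0) | _ \<Rightarrow> 0)" for z
  have blk: "(\<sigma> \<otimes>\<^sub>e eone A) z = s z \<cdot>\<^sub>m 1\<^sub>m ((C \<otimes>\<^sub>a A) z)" for z
  proof (rule eq_matI)
    fix i j assume "i < dim_row (s z \<cdot>\<^sub>m 1\<^sub>m ((C \<otimes>\<^sub>a A) z))" "j < dim_col (s z \<cdot>\<^sub>m 1\<^sub>m ((C \<otimes>\<^sub>a A) z))"
    then have ij: "i < (C \<otimes>\<^sub>a A) z" "j < (C \<otimes>\<^sub>a A) z" by simp_all
    from ij(1) obtain u v where z: "z = LPair u v" by (rule tensor_algE)
    have ij': "i < C u * A v" "j < C u * A v" using ij by (simp_all add: z)
    then have "u \<in> X" using div_mod_less(1)[OF ij'(1)] unfolding C_def by simp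
    then show "(\<sigma> \<otimes>\<^sub>e eone A) z $$ (i, j) = (s z \<cdot>\<^sub>m 1\<^sub>m ((C \<otimes>\<^sub>a A) z)) $$ (i, j)"
      using ij' by (simp add: z s_def tensor_index[OF \<sigma>e eone_elems] C_def classical_alg_in) (simp add: eone_def)
  qed (use elemsD[OF R, of z] in simp_all)
  note sb = scalar_blocks[OF D R blk]
  have "star C A \<Psi> \<sigma> = ?D *\<^sub>e (\<sigma> \<otimes>\<^sub>e eone A)"
    using cl A C \<Psi> \<sigma> sb(3) unfolding classical_limit_axiom_def C_def by blast
  moreover have "C x = 1" "munit C (x, 0, 0) = delta X x"
    using x by (simp_all add: C_def classical_alg_in munit_classical)
  ultimately show ?thesis
    using ij elemsD[OF D, of "LPair x z"] by (simp add: sb(1) s_def channel_state_index[OF C L])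
qed

section \<open>Preparation channels: measure the classical label, then emit the state attached to
  the outcome\<close>

definition prepare :: "'i alg \<Rightarrow> 'i label set \<Rightarrow> ('i label \<Rightarrow> 'i elem) \<Rightarrow> 'i elem \<Rightarrow> 'i elem" where
  "prepare A X w = (\<lambda>c\<in>elems (classical_alg X). esum A (\<lambda>x. c x $$ (0, 0) \<cdot>\<^sub>e w x) X)"

lemma etr_esum:
  assumes "finite S" "\<And>s. s \<in> S \<Longrightarrow> f s \<in> elems A"
  shows "etr A (esum A f S) = (\<Sum>s\<in>S. etr A (f s))"
  using assms
  by induction (simp_all add: esum_empty esum_insert etr_lin(1)[of _ A], simp add: etr_def ezero_def)

lemma etr_classical:
  assumes "finite X"
  shows "etr (classical_alg X) c = (\<Sum>x\<in>X. c x $$ (0, 0))"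
  using assms by (simp add: etr_def classical_alg_def lessThan_Suc)

text \<open>With an ancilla, the output block is the sum over \<open>x\<close> of the
  \<open>x\<close>-component of the input tensored with \<open>w x\<close>. Products of their Gram
  vectors are Gram vectors of the sum, and the traces of the \<open>w x\<close> being 1 gives trace
  preservation.\<close>

lemma prepare_CPTP:
  assumes A: "multi_matrix A" and X: "finite X" and w: "\<And>x. x \<in> X \<Longrightarrow> w x \<in> states A"
  shows "prepare A X w \<in> CPTP (classical_alg X) A" and "x \<in> X \<Longrightarrow> prepare A X w (delta X x) = w x"
proof -
  let ?C = "classical_alg X"
  note C = multi_matrix_classical[OF X]
  have we: "w x \<in> elems A" if "x \<in> X" for x
    using w[OF that] epos_gramE unfolding states_def by blast
  have idx: "prepare A X w c z $$ (i, j) = (\<Sum>x\<in>X. c x $$ (0, 0) * w x z $$ (i, j))"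
    if "c \<in> elems ?C" "i < A z" "j < A z" for c z i j
    using that we by (simp add: prepare_def eindex[of _ A])
  have L: "prepare A X w \<in> lin_maps ?C A"
    unfolding prepare_def
  proof (rule lin_mapsI)
    fix c c' assume c: "c \<in> elems ?C" "c' \<in> elems ?C"
    show "esum A (\<lambda>x. (c +\<^sub>e c') x $$ (0, 0) \<cdot>\<^sub>e w x) X =
      esum A (\<lambda>x. c x $$ (0, 0) \<cdot>\<^sub>e w x) X +\<^sub>e esum A (\<lambda>x. c' x $$ (0, 0) \<cdot>\<^sub>e w x) X"
      by (rule elems_eqI[where A = A])
        (use c we in \<open>auto simp: eindex[of _ A] eindex[of _ ?C] distrib_right sum.distrib\<close>)
  next
    fix k c assume c: "c \<in> elems ?C"
    show "esum A (\<lambda>x. (k \<cdot>\<^sub>e c) x $$ (0, 0) \<cdot>\<^sub>e w x) X = k \<cdot>\<^sub>e esum A (\<lambda>x. c x $$ (0, 0) \<cdot>\<^sub>e w x) X"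
      by (rule elems_eqI[where A = A])
        (use c we in \<open>auto simp: eindex[of _ A] eindex[of _ ?C] sum_distrib_left mult.assoc\<close>)
  qed simp
  have "epos (F \<otimes>\<^sub>a A) (id_tensor F ?C A (prepare A X w) T)"
    if F: "multi_matrix F" and T: "epos (F \<otimes>\<^sub>a ?C) T" for F :: "'a alg" and T
  proof -
    obtain c where Te: "T \<in> elems (F \<otimes>\<^sub>a ?C)"
      and c: "\<And>z i j. i < (F \<otimes>\<^sub>a ?C) z \<Longrightarrow> j < (F \<otimes>\<^sub>a ?C) z \<Longrightarrow>
        T z $$ (i, j) = (\<Sum>k<(F \<otimes>\<^sub>a ?C) z. cnj (c z k i) * c z k j)"
      using epos_gramE[OF T] by metis
    have "\<exists>g. \<forall>y i j. i < A y \<longrightarrow> j < A y \<longrightarrow> w x y $$ (i, j) = (\<Sum>k<A y. cnj (g y k i) * g y k j)"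
      if "x \<in> X" for x
    proof -
      have "epos A (w x)" using w[OF that] unfolding states_def by simp
      then show ?thesis by (rule epos_gramE) blast
    qed
    then obtain g where g: "\<And>x y i j. x \<in> X \<Longrightarrow> i < A y \<Longrightarrow> j < A y \<Longrightarrow>
        w x y $$ (i, j) = (\<Sum>k<A y. cnj (g x y k i) * g x y k j)"
      by metis
    let ?S = "\<lambda>z. case z of Lbl _ \<Rightarrow> {} | LPair l y \<Rightarrow> X \<times> {..<F l} \<times> {..<A y}"
    let ?f = "\<lambda>z (x, m, k) i. case z of Lbl _ \<Rightarrow> 0 | LPair l y \<Rightarrow>
      c (LPair l x) m (i div A y) * g x y k (i mod A y)"
    show ?thesis
    proof (rule epos_gramI[where S = ?S and f = ?f])
      show "id_tensor F ?C A (prepare A X w) T \<in> elems (F \<otimes>\<^sub>a A)"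
        using lin_mapsD(1)[OF id_tensor(1)[OF C F L] Te] .
      show "finite (?S z)" for z using X by (auto split: label.splits)
      fix z i j assume ij: "i < (F \<otimes>\<^sub>a A) z" "j < (F \<otimes>\<^sub>a A) z"
      from ij(1) obtain l y where z: "z = LPair l y" by (rule tensor_algE)
      have ij': "i < F l * A y" "j < F l * A y" using ij by (simp_all add: z)
      note dm = div_mod_less[OF ij'(1)] div_mod_less[OF ij'(2)]
      have "id_tensor F ?C A (prepare A X w) T z $$ (i, j) =
          (\<Sum>x\<in>X. T (LPair l x) $$ (i div A y, j div A y) * w x y $$ (i mod A y, j mod A y))"
        using dm by (simp add: z id_tensor_index[OF C F L Te ij'] idx slice_index classical_alg_in)
      also have "\<dots> = (\<Sum>x\<in>X. \<Sum>m<F l. \<Sum>k<A y. cnj (?f z (x, m, k) i) * ?f z (x, m, k) j)"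
        using dm by (intro sum.cong refl)
          (simp add: z c g classical_alg_in sum_product mult_ac, rule sum.swap)
      finally show "id_tensor F ?C A (prepare A X w) T z $$ (i, j) = (\<Sum>k\<in>?S z. cnj (?f z k i) * ?f z k j)"
        by (simp add: z sum.cartesian_product split_def)
    qed
  qed
  moreover have "etr A (prepare A X w c) = etr ?C c" if "c \<in> elems ?C" for c
    using that X we w by (simp add: prepare_def etr_esum etr_smult[of _ A] etr_classical states_def)
  ultimately show "prepare A X w \<in> CPTP ?C A"
    using L by (simp add: CPTP_def completely_positive_def positive_map_def)
  show "prepare A X w (delta X x) = w x" if x: "x \<in> X"
  proof (rule elems_eqI[where A = A])
    fix z i j assume "i < A z" "j < A z"
    then have "prepare A X w (delta X x) z $$ (i, j) = (\<Sum>y\<in>X. delta X x y $$ (0, 0) * w y z $$ (i, j))"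
      by (simp add: idx)
    also have "\<dots> = (\<Sum>y\<in>X. if y = x then w x z $$ (i, j) else 0)"
      by (intro sum.cong refl) (simp add: delta_index)
    finally show "prepare A X w (delta X x) z $$ (i, j) = w x z $$ (i, j)" using X x by simp
  qed (use x we lin_mapsD(1)[OF L] in auto)
qed

section \<open>The Bayesian inverse\<close>

lemma epos_smult:
  assumes a: "epos A a" and t: "t \<ge> 0"
  shows "epos A (of_real t \<cdot>\<^sub>e a)"
proof -
  obtain c where ae: "a \<in> elems A"
    and c: "\<And>x i j. i < A x \<Longrightarrow> j < A x \<Longrightarrow> a x $$ (i, j) = (\<Sum>k<A x. cnj (c x k i) * c x k j)"
    using epos_gramE[OF a] by metis
  have "of_real t = (of_real (sqrt t) * of_real (sqrt t) :: complex)"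
    using t by (simp flip: of_real_mult)
  then show ?thesis
    using ae by (intro epos_gramI[where S = "\<lambda>x. {..<A x}" and f = "\<lambda>x k i. of_real (sqrt t) * c x k i"])
      (simp_all add: eindex[of _ A] c sum_distrib_left mult_ac)
qed

lemma epos_tensor:
  assumes a: "epos A a" and b: "epos B b"
  shows "epos (A \<otimes>\<^sub>a B) (a \<otimes>\<^sub>e b)"
proof -
  obtain c where ae: "a \<in> elems A"
    and c: "\<And>x i j. i < A x \<Longrightarrow> j < A x \<Longrightarrow> a x $$ (i, j) = (\<Sum>k<A x. cnj (c x k i) * c x k j)"
    using epos_gramE[OF a] by metis
  obtain d where be: "b \<in> elems B"
    and d: "\<And>x i j. i < B x \<Longrightarrow> j < B x \<Longrightarrow> b x $$ (i, j) = (\<Sum>k<B x. cnj (d x k i) * d x k j)"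
    using epos_gramE[OF b] by metis
  let ?S = "\<lambda>z. case z of Lbl _ \<Rightarrow> {} | LPair x y \<Rightarrow> {..<A x} \<times> {..<B y}"
  let ?f = "\<lambda>z (k, m) i. case z of Lbl _ \<Rightarrow> 0 | LPair x y \<Rightarrow> c x k (i div B y) * d y m (i mod B y)"
  show ?thesis
  proof (rule epos_gramI[where S = ?S and f = ?f])
    show "a \<otimes>\<^sub>e b \<in> elems (A \<otimes>\<^sub>a B)" using ae be by simp
    show "finite (?S z)" for z by (auto split: label.splits)
    fix z i j assume ij: "i < (A \<otimes>\<^sub>a B) z" "j < (A \<otimes>\<^sub>a B) z"
    from ij(1) obtain x y where z: "z = LPair x y" by (rule tensor_algE)
    have ij': "i < A x * B y" "j < A x * B y" using ij by (simp_all add: z)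
    note dm = div_mod_less[OF ij'(1)] div_mod_less[OF ij'(2)]
    have "(a \<otimes>\<^sub>e b) z $$ (i, j) = (\<Sum>k<A x. cnj (c x k (i div B y)) * c x k (j div B y)) *
        (\<Sum>m<B y. cnj (d y m (i mod B y)) * d y m (j mod B y))"
      using dm by (simp add: z tensor_index[OF ae be ij'] c d)
    also have "\<dots> = (\<Sum>k<A x. \<Sum>m<B y. cnj (?f z (k, m) i) * ?f z (k, m) j)"
      by (simp add: z sum_product mult_ac)
    finally show "(a \<otimes>\<^sub>e b) z $$ (i, j) = (\<Sum>k\<in>?S z. cnj (?f z k i) * ?f z k j)"
      by (simp add: z sum.cartesian_product split_def)
  qed
qed

lemma delta_state:
  assumes X: "finite X" and x: "x \<in> X"
  shows "delta X x \<in> states (classical_alg X)"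
proof -
  have "epos (classical_alg X) (delta X x)"
    by (rule epos_gramI[where S = "\<lambda>y. if y = x then {()} else {}" and f = "\<lambda>_ _ _. 1"])
      (auto simp: delta_index)
  moreover have "etr (classical_alg X) (delta X x) = (\<Sum>y\<in>X. if y = x then 1 else 0)"
    unfolding etr_classical[OF X] by (intro sum.cong refl) (simp add: delta_index)
  ultimately show ?thesis using X x by (simp add: states_def)
qed

text \<open>A nonzero positive element has strictly positive trace, so the normalization is a
  nonnegative real scaling and keeps positivity.\<close>

lemma normalized_tensor_delta_state:
  assumes B: "multi_matrix B" and X: "finite X" and x: "x \<in> X"
    and b: "epos B b" "b \<noteq> ezero B"
  shows "((1 / etr B b) \<cdot>\<^sub>e b) \<otimes>\<^sub>e delta X x \<in> states (B \<otimes>\<^sub>a classical_alg X)"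
proof -
  obtain t where t: "t \<ge> 0" "etr B b = of_real t" using epos_trace(1)[OF B b(1)] by blast
  have nz: "etr B b \<noteq> 0" using epos_trace(2)[OF B b(1)] b(2) by blast
  have be: "b \<in> elems B" using epos_gramE[OF b(1)] by blast
  note dl = delta_state[OF X x]
  have "epos B (of_real (1 / t) \<cdot>\<^sub>e b)" using t by (intro epos_smult b) simp
  then have "epos B ((1 / etr B b) \<cdot>\<^sub>e b)" by (simp add: t)
  moreover have "etr B ((1 / etr B b) \<cdot>\<^sub>e b) = 1" using nz by (simp add: etr_smult[OF be])
  ultimately show ?thesis
    using dl be by (simp add: states_def epos_tensor etr_tensor[of _ B])
qed

text \<open>Both sides of the Bayes equation are brought entrywise to the form
  \<open>cnj (etr B (r x) * _)\<close>, with the prescribed value on one side and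
  \<open>\<Psi> (delta X x)\<close> on the other. The traces are nonzero, so they cancel.\<close>

lemma bayesian_inverse_iff:
  assumes sot: "state_over_time_function star" and cl: "classical_limit_axiom star"
    and B: "multi_matrix B" and X: "finite X"
    and \<rho>: "\<rho> \<in> states (B \<otimes>\<^sub>a classical_alg X)"
    and r: "\<And>x. x \<in> X \<Longrightarrow> epos B (r x)"
    and \<rho>r: "\<rho> = esum (B \<otimes>\<^sub>a classical_alg X) (\<lambda>x. r x \<otimes>\<^sub>e delta X x) X"
    and rnz: "\<And>x. x \<in> X \<Longrightarrow> r x \<noteq> ezero B"
    and \<Psi>: "\<Psi> \<in> CPTP (classical_alg X) (B \<otimes>\<^sub>a classical_alg X)"
  shows "bayesian_inverse star (B \<otimes>\<^sub>a classical_alg X) (classical_alg X) (ptr_fst B (classical_alg X)) \<rho> \<Psi>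
    \<longleftrightarrow> (\<forall>x\<in>X. \<Psi> (delta X x) = ((1 / etr B (r x)) \<cdot>\<^sub>e r x) \<otimes>\<^sub>e delta X x)"
proof -
  define C where "C = classical_alg X"
  define A where "A = B \<otimes>\<^sub>a C"
  define E where "E = ptr_fst B C"
  define \<sigma> where "\<sigma> = E \<rho>"
  define W where "W x = ((1 / etr B (r x)) \<cdot>\<^sub>e r x) \<otimes>\<^sub>e delta X x" for x
  note defs = C_def A_def E_def
  have C: "multi_matrix C" unfolding C_def using X by (rule multi_matrix_classical)
  have A: "multi_matrix A" unfolding A_def using B C by (rule multi_matrix_tensor)
  have C1: "C x = 1" if "x \<in> X" for x using that by (simp add: C_def classical_alg_in)
  have Xlt: "y \<in> X" if "i < A (LPair b y)" for b y i
    using that unfolding A_def C_def by (auto simp: classical_alg_def split: if_splits)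
  have re: "r x \<in> elems B" if "x \<in> X" for x using epos_gramE[OF r[OF that]] by blast
  have E: "E \<in> CPTP A C" unfolding E_def A_def by (rule ptr_fst_CPTP[OF B C])
  have \<Psi>A: "\<Psi> \<in> CPTP C A" using \<Psi> by (simp add: defs)
  have \<rho>A: "\<rho> \<in> states A" using \<rho> by (simp add: defs)
  have \<rho>e: "\<rho> \<in> elems A" using \<rho>A epos_gramE unfolding states_def by blast
  have \<sigma>: "\<sigma> \<in> states C"
    using \<rho>A E \<rho>e epos_ptr_fst[OF B C, of \<rho>] by (simp add: states_def \<sigma>_def CPTP_def E_def A_def)
  have W: "W x \<in> elems A" if "x \<in> X" for x using re[OF that] by (simp add: W_def defs)
  have L: "\<Psi> (delta X x) \<in> elems A" for x
    using \<Psi> lin_mapsD(1)[of \<Psi> C A] by (simp add: CPTP_def defs)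
  have rd: "(b \<otimes>\<^sub>e delta X x) (LPair u y) $$ (i, j) = (if x = y then b u $$ (i, j) else 0)"
    if "b \<in> elems B" "y \<in> X" "i < B u" "j < B u" for b u y i j x
    using that C1[OF that(2)] tensor_index[of b B "delta X x" C i u y j]
      delta_elems[of X x, folded C_def]
    by (simp add: delta_index)
  have \<rho>i: "\<rho> (LPair u y) $$ (i, j) = r y u $$ (i, j)" if "y \<in> X" "i < B u" "j < B u" for u y i j
  proof -
    have "\<rho> (LPair u y) $$ (i, j) = (\<Sum>x\<in>X. (r x \<otimes>\<^sub>e delta X x) (LPair u y) $$ (i, j))"
      using that C1[OF that(1)] by (simp add: \<rho>r eindex(1) C_def)
    also have "\<dots> = (\<Sum>x\<in>X. if x = y then r y u $$ (i, j) else 0)"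
      using that by (intro sum.cong refl) (auto simp: rd re)
    finally show ?thesis using X that by simp
  qed
  \<comment> \<open>The marginal on the classical factor assigns to \<open>x\<close> the weight tr
    \<rho>_x, which is the factor produced by \<open>sot_from_classical\<close>.\<close>
  have \<sigma>i: "\<sigma> x $$ (0, 0) = etr B (r x)" if "x \<in> X" for x
    using that C1[OF that] \<rho>e by (simp add: \<sigma>_def E_def ptr_fst_index[OF B C] A_def \<rho>i etr_def)
  have tr: "etr B (r x) \<noteq> 0" "cnj (etr B (r x)) = etr B (r x)" if "x \<in> X" for x
    using epos_trace[OF B r[OF that]] rnz[OF that] by auto
  let ?P = "star A C E \<rho>" and ?Q = "star C A \<Psi> \<sigma>" and ?\<tau> = "time_reversal C A"
  have Pe: "?P \<in> elems (A \<otimes>\<^sub>a C)"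
    using sot A C E \<rho>A unfolding state_over_time_function_def by blast
  have Qe: "?Q \<in> elems (C \<otimes>\<^sub>a A)"
    using sot A C \<Psi> \<sigma> unfolding state_over_time_function_def defs by blast
  have \<tau>e: "?\<tau> ?Q \<in> elems (A \<otimes>\<^sub>a C)"
    using time_reversal(1)[OF A C] Qe by (auto simp: conj_lin_maps_def)
  \<comment> \<open>Written with conjugated, transposed entries to match the output of time
    reversal; \<open>r x\<close> is Hermitian and its trace is real, so nothing changes.\<close>
  have Pi: "?P (LPair z x) $$ (i, j) = cnj (etr B (r x) * W x z $$ (j, i))"
    if x: "x \<in> X" and ij: "i < A z" "j < A z" for x z i j
  proof -
    from ij(1) obtain b y where z: "z = LPair b y" unfolding A_def by (rule tensor_algE)
    have y: "y \<in> X" using Xlt ij(1) by (simp add: z)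
    have ij': "i < B b" "j < B b" using ij C1[OF y] by (simp_all add: z A_def)
    have "?P (LPair z x) $$ (i, j) = (if y = x then r x b $$ (i, j) else 0)"
      using sot_ptr_fst_classical[OF cl B X \<rho> y x ij'] ij' x y by (simp add: z defs \<rho>i)
    moreover have "etr B (r x) * W x z $$ (j, i) = (if y = x then r x b $$ (j, i) else 0)"
      using x y ij' tr[OF x] re[OF x] by (simp add: W_def z rd eindex[of _ B])
    ultimately show ?thesis using epos_hermitian[OF r[OF x] ij'(2,1)] by simp
  qed
  \<comment> \<open>The classical digit is 0 because \<open>C x = 1\<close>, so the swap of factors
    leaves \<open>i\<close> and \<open>j\<close> alone and only the adjoint is visible.\<close>
  have \<tau>i: "?\<tau> ?Q (LPair z x) $$ (i, j) = cnj (etr B (r x) * \<Psi> (delta X x) z $$ (j, i))"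
    if x: "x \<in> X" and ij: "i < A z" "j < A z" for x z i j
    using time_reversal_index[OF A C Qe, of i z x j] ij C1[OF x]
      sot_from_classical[where X = X, folded C_def, OF cl A X \<Psi>A \<sigma> x ij(2,1)]
    by (simp add: \<sigma>i[OF x])
  have "?P = ?\<tau> ?Q \<longleftrightarrow> (\<forall>x\<in>X. \<Psi> (delta X x) = W x)"
  proof
    assume eq: "?P = ?\<tau> ?Q"
    show "\<forall>x\<in>X. \<Psi> (delta X x) = W x"
    proof
      fix x assume x: "x \<in> X"
      show "\<Psi> (delta X x) = W x"
        by (rule elems_eqI[OF L W[OF x]]) (use Pi[OF x] \<tau>i[OF x] eq tr[OF x] in auto)
    qed
  next
    assume eq: "\<forall>x\<in>X. \<Psi> (delta X x) = W x"
    show "?P = ?\<tau> ?Q"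
    proof (rule elems_eqI[OF Pe \<tau>e])
      fix v i j assume ij: "i < (A \<otimes>\<^sub>a C) v" "j < (A \<otimes>\<^sub>a C) v"
      \<comment> \<open>Labels with \<open>x\<close> outside \<open>X\<close> have empty blocks, so
        the agreement over \<open>X\<close> covers all entries.\<close>
      from ij(1) obtain z x where v: "v = LPair z x" and "i < A z * C x" by (rule tensor_algE)
      then have x: "x \<in> X" by (auto simp: C_def classical_alg_def split: if_splits)
      then show "?P v $$ (i, j) = ?\<tau> ?Q v $$ (i, j)"
        using ij C1[OF x] eq by (simp add: v Pi \<tau>i)
    qed
  qed
  then show ?thesis
    using E \<rho>A \<Psi> unfolding bayesian_inverse_def W_def \<sigma>_def by (simp add: defs)
qed

theorem mainTheorem1:
  fixes star :: "'i sot"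
    and B :: "'i alg"
    and X :: "'i label set"
    and \<rho> :: "'i elem"
    and r :: "'i label \<Rightarrow> 'i elem"
  assumes "state_over_time_function star"
    and "classical_limit_axiom star"
    and "multi_matrix B"
    and "finite X"
    and "\<rho> \<in> states (B \<otimes>\<^sub>a classical_alg X)"
    and "\<And>x. x \<in> X \<Longrightarrow> epos B (r x)"
    and "\<rho> = esum (B \<otimes>\<^sub>a classical_alg X) (\<lambda>x. r x \<otimes>\<^sub>e delta X x) X"
    and "\<And>x. x \<in> X \<Longrightarrow> r x \<noteq> ezero B"
  shows "(\<exists>!\<Psi>. bayesian_inverse star (B \<otimes>\<^sub>a classical_alg X) (classical_alg X)
                 (ptr_fst B (classical_alg X)) \<rho> \<Psi>) \<and>
         (\<forall>\<Psi>. bayesian_inverse star (B \<otimes>\<^sub>a classical_alg X) (classical_alg X)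
                 (ptr_fst B (classical_alg X)) \<rho> \<Psi> \<longrightarrow>
            (\<forall>x\<in>X. \<Psi> (delta X x) = ((1 / etr B (r x)) \<cdot>\<^sub>e r x) \<otimes>\<^sub>e delta X x))"
proof -
  let ?C = "classical_alg X" and ?A = "B \<otimes>\<^sub>a classical_alg X"
  let ?inv = "bayesian_inverse star ?A ?C (ptr_fst B ?C) \<rho>"
  let ?w = "\<lambda>x. ((1 / etr B (r x)) \<cdot>\<^sub>e r x) \<otimes>\<^sub>e delta X x"
  have A: "multi_matrix ?A"
    using assms(3) multi_matrix_classical[OF assms(4)] by (rule multi_matrix_tensor)
  \<comment> \<open>Membership in CPTP is part of being a Bayesian inverse, so the criterion extends
    to arbitrary functions.\<close>
  have iff: "?inv \<Psi> \<longleftrightarrow> \<Psi> \<in> CPTP ?C ?A \<and> (\<forall>x\<in>X. \<Psi> (delta X x) = ?w x)" for \<Psi>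
    using bayesian_inverse_iff[OF assms(1-5) assms(6) assms(7) assms(8)]
    by (auto simp: bayesian_inverse_def)
  have w: "?w x \<in> states ?A" if "x \<in> X" for x
    using normalized_tensor_delta_state[OF assms(3,4) that assms(6)[OF that] assms(8)[OF that]] .
  \<comment> \<open>Existence: the channel that prepares the normalized \<rho>_x tensored with
    \<open>delta X x\<close> has the required values.\<close>
  have "?inv (prepare ?A X ?w)"
    using prepare_CPTP[where w = ?w, OF A assms(4) w] unfolding iff by blast
  moreover have "\<Phi> = \<Psi>" if "?inv \<Phi>" "?inv \<Psi>" for \<Phi> \<Psi>
    using that unfolding iff by (intro lin_classical_eqI[OF assms(4), of _ ?A]) (auto simp: CPTP_def)
  ultimately show ?thesis using iff by blast
qed

end
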